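(* Let $\Phi:\mathbb{R}\to\mathbb{R}$ be given by $\Phi(\xi)=|\xi|^{1/2}$ for $\xi\in\mathbb{R}$. Then there exists a constant $C>0$ such that the estimate $$\lVert e^{it\Phi(D)}\varphi\rVert_{L_x^{\infty}(\mathbb{R})}\leq C(1+|t|)^{-1/2}\Big(\lVert \varphi\rVert_{H_x^1(\mathbb{R})}+\lVert x\,\partial_x\varphi\rVert_{L_x^2(\mathbb{R})}\Big)$$ holds for every $t\in\mathbb{R}$ and every $\varphi\in \mathcal{S}(\mathbb{R})$.
   Context: $\mathcal{S}(\mathbb{R})$ is the Schwartz space of (complex-valued) functions on $\mathbb{R}$, $\partial_x=\frac{d}{dx}$, and $H_x^1(\mathbb{R})$ is the usual $L^2$-based Sobolev space of order one. $x\,\partial_x\varphi$ denotes the function $x\mapsto x\varphi'(x)$. The Fourier transform is $\widehat{f}(\xi)=\int_{\mathbb{R}}e^{-ix\xi}f(x)\,dx$ (up to a normalizing factor of $2\pi$, which only affects constants). The operator $e^{it\Phi(D)}$ is the Fourier multiplier defined by $$\widehat{e^{it\Phi(D)}\varphi}(\xi)=e^{it\Phi(\xi)}\widehat{\varphi}(\xi),\qquad \varphi\in\mathcal{S}(\mathbb{R}).$$ *)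

theory Defs
  imports "HOL-Probability.Essential_Supremum"
begin

definition deriv_R :: "(real \<Rightarrow> complex) \<Rightarrow> real \<Rightarrow> complex" where
  "deriv_R f x = vector_derivative f (at x)"

text \<open>
  Differentiability of every iterated derivative at every point says that the function
  is smooth, and that \<open>deriv_R ^^ n\<close> is the genuine n-th derivative.
\<close>
definition schwartz :: "(real \<Rightarrow> complex) set" where
  "schwartz = {f.
     (\<forall>n x. (deriv_R ^^ n) f differentiable at x) \<and>
     (\<forall>k n. \<exists>B. \<forall>x. \<bar>x\<bar> ^ k * cmod ((deriv_R ^^ n) f x) \<le> B)}"

text \<open>
  The Bochner integral of a non-integrable function is 0, so \<open>L2_norm\<close> is the \<open>L\<^sup>2\<close> norm only
  of square-integrable functions.
\<close>
definition L2_norm :: "(real \<Rightarrow> complex) \<Rightarrow> real" where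
  "L2_norm f = sqrt (LINT x|lborel. (cmod (f x))\<^sup>2)"

definition H1_norm :: "(real \<Rightarrow> complex) \<Rightarrow> real" where
  "H1_norm f = sqrt ((L2_norm f)\<^sup>2 + (L2_norm (deriv_R f))\<^sup>2)"

text \<open>Extended-real valued; infinite for essentially unbounded or non-measurable functions.\<close>
definition Linf_norm :: "(real \<Rightarrow> complex) \<Rightarrow> ereal" where
  "Linf_norm f = esssup lborel (\<lambda>x. ereal (cmod (f x)))"

definition fourier :: "(real \<Rightarrow> complex) \<Rightarrow> real \<Rightarrow> complex" where
  "fourier f \<xi> = (LINT x|lborel. exp (- (\<i> * of_real (x * \<xi>))) * f x)"

text \<open>With the normalization of \<open>fourier\<close>, the factor \<open>1 / (2 * pi)\<close> belongs to the inverse.\<close>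
definition inverse_fourier :: "(real \<Rightarrow> complex) \<Rightarrow> real \<Rightarrow> complex" where
  "inverse_fourier g x =
     1 / (2 * of_real pi) * (LINT \<xi>|lborel. exp (\<i> * of_real (x * \<xi>)) * g \<xi>)"

text \<open>
  The operator \<open>exp (i t \<Phi>(D))\<close>: the function with Fourier transform
  \<open>exp (i t \<Phi>(\<xi>)) * fourier \<phi> \<xi>\<close>.  For Schwartz \<open>\<phi>\<close> and measurable real \<open>\<Phi>\<close> this is
  integrable in \<open>\<xi>\<close>, so the inverse transform is an absolutely convergent integral.
\<close>
definition propagator :: "(real \<Rightarrow> real) \<Rightarrow> real \<Rightarrow> (real \<Rightarrow> complex) \<Rightarrow> real \<Rightarrow> complex" where
  "propagator \<Phi> t \<phi> =
     inverse_fourier (\<lambda>\<xi>. exp (\<i> * of_real (t * \<Phi> \<xi>)) * fourier \<phi> \<xi>)"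

end

theory Submission
  imports Defs "HOL-Probability.Sinc_Integral" "HOL-Probability.Characteristic_Functions"
begin

text \<open>
  On the Fourier side the hypotheses control \<open>f\<close>, \<open>F = \<xi> f\<close> and \<open>F'\<close> in \<open>L\<^sup>2\<close>, where \<open>f\<close> is the
  transform of \<open>\<phi>\<close> and \<open>F\<close> is, up to a factor \<open>\<i>\<close>, that of \<open>\<phi>'\<close>; in particular
  \<open>\<bar>F(\<xi>)\<bar>\<^sup>2 \<le> C \<bar>\<xi>\<bar>\<^bsup>1/2\<^esup>\<close>.  Only the upper bound in Plancherel's theorem is needed; it
  follows by testing with a Gaussian weight, whose transform is an approximate identity, and Fatou.
  With \<open>T = \<bar>t\<bar> \<ge> 1\<close>, the frequencies \<open>\<bar>\<xi>\<bar> \<le> T\<^bsup>-2\<^esup>\<close> and \<open>\<bar>\<xi>\<bar> \<ge> T\<^sup>2\<close> contribute \<open>O(1/T)\<close> by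
  Cauchy-Schwarz.  On the rest, the substitution \<open>\<xi> = s\<^sup>2\<close> makes the phase quadratic,
  \<open>\<psi>(s) = x s\<^sup>2 + t s\<close>, and one integrates by parts with
  \<open>exp(i\<psi>) = (\<psi>' exp(i\<psi>))' / (\<psi>'' + i \<psi>'\<^sup>2)\<close>.  The denominator never vanishes, so no cutoff around
  the stationary point is needed, and everything reduces to the single bound
  \<open>\<integral> s\<^bsup>-3/2\<^esup> / (2\<bar>x\<bar> + \<psi>'\<^sup>2) ds \<le> C T\<^bsup>-3/2\<^esup>\<close> over \<open>s \<ge> 1/T\<close>, uniformly in \<open>x\<close>.
\<close>

section \<open>The oscillatory integral\<close>

lemma integral_square_substitution:
  fixes u :: "real \<Rightarrow> 'a::euclidean_space"
  assumes "0 \<le> a" "a \<le> b" "continuous_on {a\<^sup>2..b\<^sup>2} u"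
  shows "integral {a\<^sup>2..b\<^sup>2} u = integral {a..b} (\<lambda>s. (2 * s) *\<^sub>R u (s\<^sup>2))"
proof -
  have "((\<lambda>s. (2 * s) *\<^sub>R u (s\<^sup>2)) has_integral (integral {a\<^sup>2..b\<^sup>2} u)) {a..b}"
    by (rule has_integral_substitution[where c="a\<^sup>2" and d="b\<^sup>2"])
       (use assms in \<open>auto intro!: derivative_eq_intros power_mono\<close>)
  then show ?thesis by (simp add: integral_unique)
qed

text \<open>The integrand has an arctangent as antiderivative, and an arctangent varies by at most
  pi. The bound is the value over the whole line, so it does not depend on \<open>t\<close>,
  \<open>a\<close> or \<open>b\<close>.\<close>

lemma quadratic_kernel_integral:
  fixes x t :: real
  assumes "x \<noteq> 0" "a \<le> b"
  shows "integral {a..b} (\<lambda>s. 1 / (2 * \<bar>x\<bar> + (t + 2 * x * s)\<^sup>2)) \<le> pi / (2 * \<bar>x\<bar> * sqrt (2 * \<bar>x\<bar>))"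
proof -
  define c where "c = sqrt (2 * \<bar>x\<bar>)"
  have c: "c > 0" "c\<^sup>2 = 2 * \<bar>x\<bar>" using assms by (auto simp: c_def)
  define A where "A s = arctan ((t + 2 * x * s) / c) / (2 * x * c)" for s
  have "(A has_vector_derivative 1 / (2 * \<bar>x\<bar> + (t + 2 * x * s)\<^sup>2)) (at s within {a..b})" for s
  proof -
    have p: "c\<^sup>2 + (t + 2 * x * s)\<^sup>2 > 0" using c(1) by (intro add_pos_nonneg) auto
    have "((\<lambda>s. (t + 2 * x * s) / c) has_real_derivative 2 * x / c) (at s within {a..b})"
      using c by (auto intro!: derivative_eq_intros)
    from DERIV_cdivide[OF DERIV_chain2[OF DERIV_arctan this]]
    have "(A has_real_derivative (1 / (1 + ((t + 2 * x * s) / c)\<^sup>2)) * (2 * x / c) / (2 * x * c)) (at s within {a..b})"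
      unfolding A_def inverse_eq_divide .
    moreover have "(1 / (1 + ((t + 2 * x * s) / c)\<^sup>2)) * (2 * x / c) / (2 * x * c) = 1 / (c\<^sup>2 + (t + 2 * x * s)\<^sup>2)"
    proof -
      have "1 + ((t + 2 * x * s) / c)\<^sup>2 = (c\<^sup>2 + (t + 2 * x * s)\<^sup>2) / c\<^sup>2"
        using c(1) unfolding power_divide by (simp add: add_divide_distrib[of "c\<^sup>2"])
      moreover have "1 / (N / c\<^sup>2) * (2 * x / c) / (2 * x * c) = 1 / N" for N :: real
        using c(1) assms(1) by (simp add: power2_eq_square)
      ultimately show ?thesis by (simp only:)
    qed
    ultimately show ?thesis using c by (simp add: has_real_derivative_iff_has_vector_derivative)
  qed
  from fundamental_theorem_of_calculus[OF assms(2) this]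
  have "integral {a..b} (\<lambda>s. 1 / (2 * \<bar>x\<bar> + (t + 2 * x * s)\<^sup>2)) = A b - A a"
    by (rule integral_unique)
  also have "\<dots> = (arctan ((t + 2 * x * b) / c) - arctan ((t + 2 * x * a) / c)) / (2 * x * c)"
    by (simp add: A_def diff_divide_distrib)
  also have "\<dots> \<le> \<bar>arctan ((t + 2 * x * b) / c) - arctan ((t + 2 * x * a) / c)\<bar> / \<bar>2 * x * c\<bar>"
    by (metis abs_divide abs_ge_self)
  also have "\<dots> \<le> pi / \<bar>2 * x * c\<bar>"
    using arctan_bounded[of "(t + 2 * x * b) / c"] arctan_bounded[of "(t + 2 * x * a) / c"]
    by (intro divide_right_mono) (auto simp: abs_le_iff)
  finally show ?thesis using c by (simp add: c_def abs_mult)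
qed

lemma integral_inverse_three_halves:
  fixes a b :: real
  assumes "0 < a" "a \<le> b"
  shows "integral {a..b} (\<lambda>s. 1 / (s * sqrt s)) \<le> 2 / sqrt a"
proof -
  have "((\<lambda>s. - 2 / sqrt s) has_vector_derivative 1 / (s * sqrt s)) (at s within {a..b})" if "s \<in> {a..b}" for s
  proof -
    have s: "s > 0" using that assms by auto
    have "((\<lambda>s. - 2 / sqrt s) has_real_derivative 2 * (inverse (sqrt s) / 2) / (sqrt s * sqrt s)) (at s within {a..b})"
      by (rule derivative_eq_intros refl | use s in \<open>simp add: field_simps\<close>)+
    moreover have "2 * (inverse (sqrt s) / 2) / (sqrt s * sqrt s) = 1 / (s * sqrt s)"
      using s by (simp add: field_simps)
    ultimately show ?thesis by (simp add: has_real_derivative_iff_has_vector_derivative)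
  qed
  from fundamental_theorem_of_calculus[OF assms(2) this]
  have "integral {a..b} (\<lambda>s. 1 / (s * sqrt s)) = - 2 / sqrt b - - 2 / sqrt a"
    by (intro integral_unique) auto
  then show ?thesis using assms by auto
qed

section \<open>Kernel bounds for the phase \<open>x * s\<^sup>2 + t * s\<close>\<close>

locale sqrt_phase =
  fixes x t T :: real
  assumes T_def: "T = \<bar>t\<bar>" and T1: "T \<ge> 1"
begin

text \<open>The reciprocal of |\<psi>''| + \<psi>'^2, comparable to the reciprocal of the modulus of
  \<psi>'' + i \<psi>'^2 but easier to integrate.\<close>

definition E :: "real \<Rightarrow> real" where "E s = 1 / (2 * \<bar>x\<bar> + (t + 2 * x * s)\<^sup>2)"

lemma den_pos: "2 * \<bar>x\<bar> + (t + 2 * x * s)\<^sup>2 > 0"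
  using T_def T1 by (cases "x = 0") (auto simp: add_pos_nonneg)

lemma E_nonneg: "E s \<ge> 0"
  using den_pos[of s] by (auto simp: E_def)

lemma E_le: assumes "c > 0" "c \<le> 2 * \<bar>x\<bar> + (t + 2 * x * s)\<^sup>2" shows "E s \<le> 1 / c"
  unfolding E_def using assms by (intro divide_left_mono) auto

lemma continuous_E: "continuous_on S E"
  unfolding E_def by (intro continuous_intros) (use den_pos in \<open>auto simp: less_imp_neq[symmetric]\<close>)

text \<open>If \<open>4 * \<bar>x\<bar> * s \<le> T\<close>, then \<open>2 * x * s\<close> is at
  most half of \<open>t\<close> in modulus, so |\<psi>'| is at least \<open>T / 2\<close>. The
  second alternative contains every point near a stationary one.\<close>

lemma E_cases:
  assumes "s > 0"
  shows "E s \<le> 4 / T\<^sup>2 \<or> (T < 4 * \<bar>x\<bar> * s)"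
proof (cases "T < 4 * \<bar>x\<bar> * s")
  case False
  then have "\<bar>t + 2 * x * s\<bar> \<ge> T / 2"
    using assms T_def abs_mult[of "2 * x" s] by (auto simp: abs_if algebra_simps split: if_splits)
  then have "(T / 2)\<^sup>2 \<le> (t + 2 * x * s)\<^sup>2"
    using T1 power_mono[of "T/2" "\<bar>t + 2 * x * s\<bar>" 2] by auto
  then have "E s \<le> 1 / (T / 2)\<^sup>2"
    using T1 by (intro E_le) (auto intro: add_increasing)
  then show ?thesis by (simp add: power_divide)
qed auto

text \<open>Serves the boundary terms of the integration by parts. Away from stationarity
  \<open>4 / T\<^sup>2\<close> is enough because \<open>s \<ge> 1 / T\<close>; otherwise \<psi>''
  alone makes the denominator at least \<open>T / (2 * s)\<close>.\<close>

lemma E_le_linear: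
  assumes "s \<ge> 1 / T"
  shows "E s \<le> 4 * s / T"
proof -
  have s: "s > 0" using assms T1 by (meson less_le_trans zero_less_divide_1_iff zero_less_one)
  consider "E s \<le> 4 / T\<^sup>2" | "T < 4 * \<bar>x\<bar> * s" using E_cases[OF s] by auto
  then show ?thesis
  proof cases
    case 1
    have "4 / T\<^sup>2 = 4 * (1 / T) / T" by (simp add: power2_eq_square)
    also have "\<dots> \<le> 4 * s / T" using assms T1 by (intro divide_right_mono mult_left_mono) auto
    finally show ?thesis using 1 by simp
  next
    case 2
    have "T / (2 * s) \<le> 2 * \<bar>x\<bar>" using 2 s by (simp add: field_simps)
    then have "E s \<le> 1 / (T / (2 * s))" using T1 s by (intro E_le) (auto intro: add_increasing2)
    also have "\<dots> \<le> 4 * s / T" using T1 s by (simp add: field_simps)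
    finally show ?thesis .
  qed
qed

text \<open>A single majorant for the remainder terms of the integration by parts that do not
  involve the derivative of the amplitude, and for half of the one that does. The summand
  \<open>1 / T\<close> pays for replacing \<open>sqrt (2 * E s)\<close> by a multiple of
  \<open>E s\<close>.\<close>

definition P :: "real \<Rightarrow> real" where "P s = (T * E s + 1 / T) / (s * sqrt s)"

text \<open>
  Either \<open>s\<close> is away from the stationary point, so \<open>E s \<le> 4 / T\<^sup>2\<close>, or \<open>1 / s < 4\<bar>x\<bar> / T\<close>; adding
  the two bounds keeps the right-hand side explicitly integrable.
\<close>
lemma P_pointwise:
  assumes "s > 0"
  shows "P s \<le> 5 / T * (1 / (s * sqrt s)) + (4 * \<bar>x\<bar> / T) * sqrt (4 * \<bar>x\<bar> / T) * T * E s"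
proof -
  consider "E s \<le> 4 / T\<^sup>2" | "T < 4 * \<bar>x\<bar> * s" using E_cases[OF assms] by auto
  then show ?thesis
  proof cases
    case 1
    then have "T * E s + 1 / T \<le> T * (4 / T\<^sup>2) + 1 / T" using T1 by (intro add_right_mono mult_left_mono) auto
    also have "\<dots> = 5 / T" using T1 by (simp add: power2_eq_square field_simps)
    finally have "P s \<le> 5 / T / (s * sqrt s)" unfolding P_def using assms by (intro divide_right_mono) auto
    moreover have "0 \<le> (4 * \<bar>x\<bar> / T) * sqrt (4 * \<bar>x\<bar> / T) * T * E s" using T1 E_nonneg by auto
    ultimately show ?thesis by simp
  next
    case 2
    define r where "r = 4 * \<bar>x\<bar> / T"
    have r: "1 / s \<le> r" using 2 T1 assms by (simp add: r_def field_simps)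
    have "1 / (s * sqrt s) = (1 / s) * sqrt (1 / s)" by (simp add: real_sqrt_divide)
    also have "\<dots> \<le> r * sqrt r" using r assms by (intro mult_mono) (auto intro: order_trans[OF _ r])
    finally have "T * E s * (1 / (s * sqrt s)) \<le> T * E s * (r * sqrt r)"
      using T1 E_nonneg by (intro mult_left_mono) auto
    moreover have "1 / T * (1 / (s * sqrt s)) \<le> 5 / T * (1 / (s * sqrt s))"
      using T1 assms by (intro mult_right_mono divide_right_mono) auto
    ultimately show ?thesis unfolding P_def r_def[symmetric] by (simp add: algebra_simps add_divide_distrib)
  qed
qed

text \<open>The two summands of \<open>P_pointwise\<close> contribute \<open>10 / sqrt T\<close> and
  at most \<open>9 / sqrt T\<close>. The second vanishes for \<open>x = 0\<close> because its
  coefficient \<open>k\<close> does.\<close>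

lemma integral_P:
  assumes "1 / T \<le> b"
  shows "integral {1 / T..b} P \<le> 19 / sqrt T"
proof -
  have Tp: "T > 0" "1 / T > 0" using T1 by auto
  define k where "k = (4 * \<bar>x\<bar> / T) * sqrt (4 * \<bar>x\<bar> / T) * T"
  have pos: "s > 0" if "1 / T \<le> s" for s using that Tp(2) by linarith
  have cont1: "continuous_on {1 / T..b} (\<lambda>s. 1 / (s * sqrt s))"
    using Tp by (intro continuous_intros) auto
  have contP: "continuous_on {1 / T..b} P"
    unfolding P_def using Tp by (intro continuous_intros continuous_E) auto
  have "integral {1 / T..b} P \<le> integral {1 / T..b} (\<lambda>s. 5 / T * (1 / (s * sqrt s)) + k * E s)"
  proof (rule integral_le)
    show "P integrable_on {1 / T..b}" by (rule integrable_continuous_real[OF contP])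
    show "(\<lambda>s. 5 / T * (1 / (s * sqrt s)) + k * E s) integrable_on {1 / T..b}"
      by (intro integrable_continuous_real continuous_on_add continuous_on_mult continuous_on_const cont1 continuous_E)
    show "P s \<le> 5 / T * (1 / (s * sqrt s)) + k * E s" if "s \<in> {1 / T..b}" for s
      unfolding k_def using that by (intro P_pointwise pos) auto
  qed
  also have "\<dots> = integral {1 / T..b} (\<lambda>s. 5 / T * (1 / (s * sqrt s))) + integral {1 / T..b} (\<lambda>s. k * E s)"
    by (intro integral_add integrable_continuous_real continuous_on_mult continuous_on_const cont1 continuous_E)
  also have "\<dots> = 5 / T * integral {1 / T..b} (\<lambda>s. 1 / (s * sqrt s)) + k * integral {1 / T..b} E"
    by (simp only: integral_mult_right)
  also have "\<dots> \<le> 5 / T * (2 / sqrt (1 / T)) + 9 / sqrt T"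
  proof (intro add_mono mult_left_mono)
    show "integral {1 / T..b} (\<lambda>s. 1 / (s * sqrt s)) \<le> 2 / sqrt (1 / T)"
      by (rule integral_inverse_three_halves) (use Tp assms in auto)
    show "k * integral {1 / T..b} E \<le> 9 / sqrt T"
    proof (cases "x = 0")
      case False
      have "k * integral {1 / T..b} E \<le> k * (pi / (2 * \<bar>x\<bar> * sqrt (2 * \<bar>x\<bar>)))"
        unfolding E_def using Tp by (intro mult_left_mono quadratic_kernel_integral False assms) (auto simp: k_def)
      \<comment> \<open>Both \<open>k\<close> and the reciprocal of the whole-line bound scale like
        |x|^(3/2), so \<open>x\<close> cancels; this is the uniformity in \<open>x\<close>.\<close>
      also have "\<dots> = 2 * sqrt 2 * pi / sqrt T"
      proof -
        have "sqrt (4 * \<bar>x\<bar> / T) = sqrt 2 * sqrt (2 * \<bar>x\<bar>) / sqrt T"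
          by (simp add: real_sqrt_divide flip: real_sqrt_mult)
        then show ?thesis using Tp False by (simp add: k_def field_simps)
      qed
      also have "\<dots> \<le> 9 / sqrt T"
      proof (intro divide_right_mono)
        have "sqrt 2 * pi \<le> 1.42 * 3.15"
          by (intro mult_mono real_le_lsqrt) (use pi_approx in \<open>auto simp: power2_eq_square\<close>)
        then show "2 * sqrt 2 * pi \<le> 9" by simp
      qed (use Tp in auto)
      finally show ?thesis .
    qed (use Tp in \<open>auto simp: k_def\<close>)
  qed (use Tp in auto)
  also have "\<dots> = 19 / sqrt T"
  proof -
    have "5 / T * (2 / sqrt (1 / T)) = 10 * (sqrt T / T)" by (simp add: real_sqrt_divide)
    also have "sqrt T / T = 1 / sqrt T" using Tp by (simp add: sqrt_divide_self_eq inverse_eq_divide)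
    finally show ?thesis by simp
  qed
  finally show ?thesis .
qed

section \<open>Integration by parts with the denominator \<psi>'' + i \<psi>'^2\<close>

definition D :: "real \<Rightarrow> complex" where
  "D s = 2 * of_real x + \<i> * (of_real (t + 2 * x * s))\<^sup>2"

lemma cmod_D: "(cmod (D s))\<^sup>2 = (2 * x)\<^sup>2 + (t + 2 * x * s) ^ 4"
proof -
  have "D s = Complex (2 * x) ((t + 2 * x * s)\<^sup>2)"
    by (auto simp: D_def complex_eq_iff power2_eq_square)
  then show ?thesis by (simp add: cmod_power2)
qed

lemma D_nonzero: "D s \<noteq> 0"
proof
  assume "D s = 0"
  then have "(2 * x)\<^sup>2 + (t + 2 * x * s) ^ 4 = 0" using cmod_D[of s] by simp
  then have "x = 0" "t = 0" by (auto simp: add_nonneg_eq_0_iff)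
  then show False using T_def T1 by simp
qed

text \<open>With \<open>X\<close> for |\<psi>''| and \<open>a2\<close> for \<psi>'^2, both forms say
  \<open>a2 * (X + a2) \<le> 2 * (X\<^sup>2 + a2\<^sup>2)\<close>, which follows from
  \<open>2 * X * a2 \<le> X\<^sup>2 + a2\<^sup>2\<close>. The first form bounds \<open>w\<close>,
  the second the term in which the derivative falls on \<open>1 / D\<close>.\<close>

lemma ratio_le: "((t + 2 * x * s) / cmod (D s))\<^sup>2 \<le> 2 * E s"
  and ratio_sq_le: "(t + 2 * x * s)\<^sup>2 / (cmod (D s))\<^sup>2 \<le> 2 * E s"
proof -
  define a2 where "a2 = (t + 2 * x * s)\<^sup>2"
  define X where "X = 2 * \<bar>x\<bar>"
  have nn: "a2 \<ge> 0" "X \<ge> 0" by (auto simp: a2_def X_def)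
  have p: "X + a2 > 0" using den_pos by (simp add: a2_def X_def)
  have m: "(cmod (D s))\<^sup>2 = X\<^sup>2 + a2\<^sup>2" using cmod_D[of s] by (simp add: a2_def X_def power_mult_distrib)
  have mp: "X\<^sup>2 + a2\<^sup>2 > 0" using D_nonzero[of s] m by (metis norm_eq_zero zero_less_power2)
  have "a2 * (X + a2) \<le> 2 * (X\<^sup>2 + a2\<^sup>2)"
    using sum_squares_bound[of X a2] zero_le_power2[of X] zero_le_power2[of a2]
    unfolding distrib_left power2_eq_square[of a2, symmetric] by (simp only: mult.commute[of a2 X] mult.assoc)
  then have "a2 / (X\<^sup>2 + a2\<^sup>2) \<le> 2 / (X + a2)" using p mp by (simp add: field_simps)
  then show 2: "(t + 2 * x * s)\<^sup>2 / (cmod (D s))\<^sup>2 \<le> 2 * E s"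
    unfolding m E_def by (simp add: a2_def X_def)
  then show "((t + 2 * x * s) / cmod (D s))\<^sup>2 \<le> 2 * E s"
    by (simp add: power_divide)
qed

text \<open>If \<open>\<bar>x\<bar> * s \<le> T\<close>, the factor \<open>T\<close> in
  \<open>P\<close> absorbs \<open>\<bar>x\<bar> * s\<close>. Otherwise \<open>2 * x * s\<close>
  dominates \<open>t\<close>, so |\<psi>'| is at least \<open>\<bar>x\<bar> * s\<close>, and the
  term \<open>1 / T\<close> of \<open>P\<close> suffices.\<close>

lemma x_E_le:
  assumes s: "s > 0"
  shows "\<bar>x\<bar> * E s / sqrt s \<le> P s"
proof -
  have *: "\<bar>x\<bar> * E s * s \<le> T * E s + 1 / T"
  proof (cases "\<bar>x\<bar> * s \<le> T")
    case True
    then have "\<bar>x\<bar> * s * E s \<le> T * E s" using E_nonneg by (intro mult_right_mono)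
    moreover have "1 / T > 0" using T1 by simp
    ultimately show ?thesis by (simp only: mult.assoc mult.commute[of s])
  next
    case False
    then have "\<bar>t + 2 * x * s\<bar> \<ge> \<bar>x\<bar> * s"
      using s T_def abs_mult[of x s] by (auto simp: abs_if algebra_simps split: if_splits)
    then have "(\<bar>x\<bar> * s)\<^sup>2 \<le> (t + 2 * x * s)\<^sup>2"
      using s power_mono[of "\<bar>x\<bar> * s" "\<bar>t + 2 * x * s\<bar>" 2] by auto
    moreover have pos: "\<bar>x\<bar> * s > 0" using False T1 by linarith
    ultimately have "E s \<le> 1 / (\<bar>x\<bar> * s)\<^sup>2"
      by (intro E_le) (auto intro: add_increasing)
    then have "\<bar>x\<bar> * s * E s \<le> \<bar>x\<bar> * s * (1 / (\<bar>x\<bar> * s)\<^sup>2)" using pos by (intro mult_left_mono) auto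
    also have "\<dots> = 1 / (\<bar>x\<bar> * s)" using pos by (simp add: power2_eq_square)
    also have "\<dots> \<le> 1 / T" using False T1 by (intro divide_left_mono) auto
    finally have "\<bar>x\<bar> * E s * s \<le> 1 / T" by (simp only: mult_ac)
    moreover have "T * E s \<ge> 0" using E_nonneg[of s] T1 by simp
    ultimately show ?thesis by linarith
  qed
  have "\<bar>x\<bar> * E s / sqrt s = \<bar>x\<bar> * E s * s / (s * sqrt s)" using s by simp
  also have "\<dots> \<le> (T * E s + 1 / T) / (s * sqrt s)" using * s by (intro divide_right_mono) auto
  finally show ?thesis by (simp add: P_def)
qed

text \<open>The cross term in the square of \<open>T * E s + 1 / T\<close> is exactly
  \<open>2 * E s\<close>.\<close>

lemma sqrt_E_le:
  assumes s: "s > 0"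
  shows "sqrt (2 * E s) / (s * sqrt s) \<le> P s"
proof -
  have "sqrt (2 * E s) \<le> T * E s + 1 / T"
  proof (rule real_le_lsqrt)
    have "(T * E s + 1 / T)\<^sup>2 = (T * E s)\<^sup>2 + (1 / T)\<^sup>2 + 2 * E s"
      using T1 by (simp add: power2_eq_square field_simps)
    then show "2 * E s \<le> (T * E s + 1 / T)\<^sup>2" by simp
  qed (use T1 E_nonneg in auto)
  then show ?thesis unfolding P_def using s by (intro divide_right_mono) auto
qed

lemma E_over_s_le:
  assumes s: "s > 0" "s \<le> T"
  shows "sqrt T * E s / s \<le> P s"
proof -
  have "sqrt T * E s * sqrt s \<le> sqrt T * E s * sqrt T"
    using s E_nonneg T1 by (intro mult_left_mono) auto
  also have "\<dots> = T * E s" using T1 by simp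
  also have "\<dots> \<le> T * E s + 1 / T" using T1 by simp
  finally have "sqrt T * E s * sqrt s / (s * sqrt s) \<le> P s"
    unfolding P_def using s by (intro divide_right_mono) auto
  then show ?thesis using s by simp
qed

text \<open>The boundary term \<open>\<psi>' exp(i\<psi>) / (s (\<psi>'' + i \<psi>'\<^sup>2))\<close> of the integration by parts.\<close>
definition w :: "real \<Rightarrow> complex" where
  "w s = of_real (t + 2 * x * s) * exp (\<i> * of_real (x * s\<^sup>2 + t * s)) / (of_real s * D s)"

text \<open>The first term is the integrand wanted; the other two arise when the derivative falls on
  \<open>1 / s\<close> and on \<open>1 / D\<close>.\<close>

lemma w_deriv:
  assumes s: "s > 0"
  shows "(w has_vector_derivative exp (\<i> * of_real (x * s\<^sup>2 + t * s)) / of_real s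
     - w s / of_real s - w s * (4 * \<i> * of_real x * of_real (t + 2 * x * s)) / D s) (at s within S)"
proof -
  \<comment> \<open>\<open>Dc\<close> and \<open>wc\<close> extend \<open>D\<close> and
    \<open>w\<close> to a complex argument, so that the rules for complex derivatives apply before
    restricting to the real line.\<close>
  define Dc where "Dc z = 2 * of_real x + \<i> * (of_real t + 2 * of_real x * z)\<^sup>2" for z :: complex
  define wc where "wc z = (of_real t + 2 * of_real x * z) * exp (\<i> * (of_real x * z\<^sup>2 + of_real t * z)) / (z * Dc z)" for z :: complex
  have D: "Dc (of_real s) = D s" "wc (of_real s) = w s" for s by (auto simp: D_def Dc_def w_def wc_def)
  define e where "e = exp (\<i> * (of_real x * (of_real s)\<^sup>2 + of_real t * of_real s))"
  define a where "a = of_real t + 2 * of_real x * complex_of_real s"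
  have nz: "Dc (of_real s) \<noteq> 0" using D_nonzero D by simp
  have num: "((\<lambda>z. (of_real t + 2 * of_real x * z) * exp (\<i> * (of_real x * z\<^sup>2 + of_real t * z))) has_field_derivative
     2 * of_real x * e + a * (e * (\<i> * (of_real x * (2 * of_real s) + of_real t)))) (at (of_real s))"
    unfolding e_def a_def by (auto intro!: derivative_eq_intros)
  have den: "((\<lambda>z. z * Dc z) has_field_derivative
     Dc (of_real s) + of_real s * (\<i> * (2 * a * (2 * of_real x)))) (at (of_real s))"
    unfolding Dc_def a_def by (auto intro!: derivative_eq_intros)
  have "(wc has_field_derivative
     ((2 * of_real x * e + a * (e * (\<i> * (of_real x * (2 * of_real s) + of_real t)))) * (of_real s * Dc (of_real s))
       - a * e * (Dc (of_real s) + of_real s * (\<i> * (2 * a * (2 * of_real x)))))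
       / ((of_real s * Dc (of_real s)) * (of_real s * Dc (of_real s)))) (at (of_real s))"
    unfolding wc_def using DERIV_divide[OF num den] s nz by (simp add: e_def a_def)
  also have "((2 * of_real x * e + a * (e * (\<i> * (of_real x * (2 * of_real s) + of_real t)))) * (of_real s * Dc (of_real s))
       - a * e * (Dc (of_real s) + of_real s * (\<i> * (2 * a * (2 * of_real x)))))
       / ((of_real s * Dc (of_real s)) * (of_real s * Dc (of_real s))) =
     e / of_real s - wc (of_real s) / of_real s - wc (of_real s) * (4 * \<i> * of_real x * a) / Dc (of_real s)"
  proof -
    have 1: "of_real x * (2 * of_real s) + of_real t = a" by (simp add: a_def)
    \<comment> \<open>This is (\<psi>' exp(i\<psi>))' = (\<psi>'' + i \<psi>'^2) exp(i\<psi>), the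
      identity that dictates the choice of \<open>D\<close>.\<close>
    have 2: "2 * of_real x * e + a * (e * (\<i> * a)) = e * Dc (of_real s)"
      by (simp add: Dc_def a_def power2_eq_square algebra_simps)
    have 3: "wc (of_real s) = a * e / (of_real s * Dc (of_real s))" by (simp add: wc_def a_def e_def)
    have 4: "(e * d * (z * d) - a * e * (d + z * (\<i> * (2 * a * (2 * of_real x))))) / ((z * d) * (z * d)) =
        e / z - a * e / (z * d) / z - a * e / (z * d) * (4 * \<i> * of_real x * a) / d" if "z \<noteq> 0" "d \<noteq> 0" for z d
      using that by (simp add: divide_simps) (simp add: algebra_simps)
    show ?thesis unfolding 1 2 3 using s nz by (intro 4) auto
  qed
  finally have "((\<lambda>s. wc (of_real s)) has_vector_derivative
      e / of_real s - wc (of_real s) / of_real s - wc (of_real s) * (4 * \<i> * of_real x * a) / Dc (of_real s)) (at s within S)"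
    by (rule has_vector_derivative_real_field)
  then show ?thesis unfolding D by (simp add: e_def a_def)
qed

lemma cmod_w_le:
  assumes s: "s > 0"
  shows "cmod (w s) \<le> sqrt (2 * E s) / s"
proof -
  have "cmod (w s) = \<bar>t + 2 * x * s\<bar> / cmod (D s) / s"
    unfolding w_def norm_mult norm_divide norm_exp_i_times norm_of_real using s by simp
  also have "\<dots> \<le> sqrt (2 * E s) / s"
    using ratio_le[of s] s by (intro divide_right_mono real_le_rsqrt) (auto simp: power_divide)
  finally show ?thesis .
qed

text \<open>The derivative \<open>g'\<close> will be controlled only in a weighted square mean, so
  its term is split by Young's inequality. The other two terms use the pointwise bound on
  \<open>g\<close>. The factor 10 is 1 + 1 + 8.\<close>

lemma remainder_le:
  assumes s: "s > 0" "s \<le> T" and K: "K > 0" "cmod g \<le> K * sqrt s"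
  shows "cmod (w s * (g' - g / of_real s - 4 * \<i> * of_real x * of_real (t + 2 * x * s) / D s * g))
     \<le> 10 * K * P s + 1 / (2 * K * sqrt T) * ((cmod g')\<^sup>2 / s)"
proof -
  define q where "q = sqrt (2 * E s)"
  have q: "q \<ge> 0" "q\<^sup>2 = 2 * E s" using E_nonneg by (auto simp: q_def)
  have T: "T > 0" using T1 by simp
  have "cmod (w s * g') \<le> K * P s + 1 / (2 * K * sqrt T) * ((cmod g')\<^sup>2 / s)"
  proof -
    have "cmod (w s * g') \<le> q / s * cmod g'"
      unfolding norm_mult q_def by (intro mult_right_mono cmod_w_le s) auto
    also have "\<dots> \<le> K * (sqrt T * E s / s) + 1 / (2 * K * sqrt T) * ((cmod g')\<^sup>2 / s)"
    proof -
      \<comment> \<open>The Young parameter: with an energy of size \<open>K\<^sup>2\<close>, both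
        halves integrate to order \<open>K / sqrt T\<close>.\<close>
      define k where "k = K * sqrt T"
      have k: "k > 0" using K T by (simp add: k_def)
      have "2 * (q * k) * cmod g' \<le> (q * k)\<^sup>2 + (cmod g')\<^sup>2" by (rule sum_squares_bound)
      then have "q * cmod g' \<le> k * E s + (cmod g')\<^sup>2 / (2 * k)"
        using k q by (simp add: power_mult_distrib field_simps power2_eq_square)
      then have "q * cmod g' / s \<le> (k * E s + (cmod g')\<^sup>2 / (2 * k)) / s"
        using s by (intro divide_right_mono) auto
      then show ?thesis by (simp add: k_def add_divide_distrib mult_ac)
    qed
    also have "K * (sqrt T * E s / s) \<le> K * P s" using K s by (intro mult_left_mono E_over_s_le) auto
    finally show ?thesis by simp
  qed
  moreover have "cmod (w s * (g / of_real s)) \<le> K * P s"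
  proof -
    have "cmod (w s * (g / of_real s)) \<le> q / s * (K * sqrt s / s)"
      unfolding norm_mult norm_divide q_def using s K
      E_nonneg[of s] by (intro mult_mono cmod_w_le) (auto intro: divide_right_mono)
    also have "\<dots> = K * (q / (s * sqrt s))"
      using s by (simp add: field_simps)
    also have "\<dots> \<le> K * P s" unfolding q_def using K s by (intro mult_left_mono sqrt_E_le) auto
    finally show ?thesis .
  qed
  moreover have "cmod (w s * (4 * \<i> * of_real x * of_real (t + 2 * x * s) / D s * g)) \<le> 8 * K * P s"
  proof -
    have "cmod (w s * (4 * \<i> * of_real x * of_real (t + 2 * x * s) / D s * g))
        = 4 * \<bar>x\<bar> * ((t + 2 * x * s)\<^sup>2 / (cmod (D s))\<^sup>2) * (cmod g / s)"
      unfolding w_def norm_mult norm_divide norm_exp_i_times norm_of_real using s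
      by (simp add: power2_eq_square field_simps abs_mult_self_eq)
    also have "\<dots> \<le> 4 * \<bar>x\<bar> * (2 * E s) * (K * sqrt s / s)"
      using s K E_nonneg by (intro mult_mono ratio_sq_le divide_right_mono) auto
    also have "\<dots> = 8 * K * (\<bar>x\<bar> * E s / sqrt s)" using s by (simp add: field_simps)
    also have "\<dots> \<le> 8 * K * P s" using K s by (intro mult_left_mono x_E_le) auto
    finally show ?thesis .
  qed
  ultimately show ?thesis
    unfolding right_diff_distrib
    using norm_triangle_ineq4[of "w s * g' - w s * (g / of_real s)" "w s * (4 * \<i> * of_real x * of_real (t + 2 * x * s) / D s * g)"]
       norm_triangle_ineq4[of "w s * g'" "w s * (g / of_real s)"]
    by linarith
qed

text \<open>Integrating by parts against \<open>w\<close> leaves two boundary values and a remainder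
  of the size given by \<open>remainder_le\<close>. The hypotheses on \<open>G\<close> suit an
  amplitude of the form \<open>F (s\<^sup>2)\<close>, where |F|^2 is at most a multiple of the
  square root of the frequency and \<open>F'\<close> is square integrable.\<close>

lemma van_der_Corput_sqrt:
  fixes G G' :: "real \<Rightarrow> complex"
  assumes G: "\<And>s. s \<in> {1 / T..T} \<Longrightarrow> (G has_vector_derivative G' s) (at s within {1 / T..T})"
    and G'c: "continuous_on {1 / T..T} G'"
    and bound: "\<And>s. s \<in> {1 / T..T} \<Longrightarrow> cmod (G s) \<le> K * sqrt s"
    and K: "K \<ge> 0"
    and energy: "integral {1 / T..T} (\<lambda>s. (cmod (G' s))\<^sup>2 / s) \<le> K\<^sup>2"
  shows "cmod (integral {1 / T..T} (\<lambda>s. exp (\<i> * of_real (x * s\<^sup>2 + t * s)) * G s / of_real s)) \<le> 200 * K / sqrt T"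
\<comment> \<open>The Young parameter must be positive, so \<open>K = 0\<close>, where
  \<open>G\<close> vanishes, is treated apart.\<close>
proof (cases "K = 0")
  case True
  then have "integral {1 / T..T} (\<lambda>s. exp (\<i> * of_real (x * s\<^sup>2 + t * s)) * G s / of_real s) = integral {1 / T..T} (\<lambda>s. 0)"
    using bound by (intro integral_cong) auto
  then show ?thesis using True by simp
next
  case False
  with K have K: "K > 0" by simp
  have T: "T > 0" "1 / T > 0" using T1 by auto
  have le: "1 / T \<le> T" using T1 by (metis T(1) divide_le_eq_1_pos order_trans)
  have pos: "s > 0" if "s \<in> {1 / T..T}" for s using that T(2) by (simp, linarith)
  let ?I = "{1 / T..T}"
  define f where "f s = exp (\<i> * of_real (x * s\<^sup>2 + t * s)) * G s / of_real s" for s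
  define r where "r s = w s * (G' s - G s / of_real s - 4 * \<i> * of_real x * of_real (t + 2 * x * s) / D s * G s)" for s
  have Gc: "continuous_on ?I G" using G by (meson has_vector_derivative_continuous continuous_on_eq_continuous_within)
  have nz: "\<forall>s\<in>?I. complex_of_real s \<noteq> 0" "\<forall>s\<in>?I. s * sqrt s \<noteq> 0" "\<forall>s\<in>?I. s \<noteq> 0"
    "\<forall>s\<in>?I. T \<noteq> 0" "\<forall>s\<in>?I. D s \<noteq> 0" "\<forall>s\<in>?I. of_real s * D s \<noteq> 0"
    using pos T D_nonzero by fastforce+
  have Dc: "continuous_on ?I D" unfolding D_def by (intro continuous_intros)
  have wc: "continuous_on ?I w" unfolding w_def by (intro continuous_intros Dc nz)
  have fc: "continuous_on ?I f" unfolding f_def by (intro continuous_intros Gc nz)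
  have rc: "continuous_on ?I r" unfolding r_def by (intro continuous_intros Gc G'c wc Dc nz)
  have Pc: "continuous_on ?I P" unfolding P_def by (intro continuous_intros continuous_E nz)
  have Nc: "continuous_on ?I (\<lambda>s. (cmod (G' s))\<^sup>2 / s)" by (intro continuous_intros G'c nz)
  \<comment> \<open>\<open>f\<close> is the integrand to be estimated; \<open>r\<close> gathers the
    terms in which the derivative falls on \<open>G\<close>, \<open>1 / s\<close> or
    \<open>1 / D\<close>.\<close>
  have "((\<lambda>s. w s * G s) has_vector_derivative f s + r s) (at s within ?I)" if "s \<in> ?I" for s
  proof -
    have "((\<lambda>s. w s * G s) has_vector_derivative
       w s * G' s + (exp (\<i> * of_real (x * s\<^sup>2 + t * s)) / of_real s
         - w s / of_real s - w s * (4 * \<i> * of_real x * of_real (t + 2 * x * s)) / D s) * G s) (at s within ?I)"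
      by (intro has_vector_derivative_mult w_deriv pos that G)
    then show ?thesis by (rule back_subst[where P="\<lambda>z. (_ has_vector_derivative z) _"])
       (simp add: f_def r_def algebra_simps)
  qed
  from fundamental_theorem_of_calculus[OF le this]
  have "((\<lambda>s. f s + r s) has_integral w T * G T - w (1 / T) * G (1 / T)) ?I" .
  then have eq: "integral ?I f = w T * G T - w (1 / T) * G (1 / T) - integral ?I r"
    using integral_add[of f ?I r] integrable_continuous_real[OF fc] integrable_continuous_real[OF rc]
    by (simp add: integral_unique algebra_simps)
  have bd: "cmod (w s * G s) \<le> 3 * K / sqrt T" if "s \<in> ?I" for s
  proof -
    have s: "s > 0" by (rule pos[OF that])
    \<comment> \<open>\<open>E_le_linear\<close> gives 8 in place of 9; rounding up makes it a
      perfect square.\<close>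
    have "sqrt (2 * E s) \<le> sqrt (9 * s / T)"
      using E_le_linear[of s] that s T by (intro real_sqrt_le_mono) (auto simp: field_simps)
    also have "\<dots> = 3 * sqrt s / sqrt T" by (simp add: real_sqrt_mult real_sqrt_divide)
    finally have "cmod (w s) \<le> 3 * sqrt s / sqrt T / s"
      using cmod_w_le[OF s] s by (meson divide_right_mono less_imp_le order_trans)
    then have "cmod (w s * G s) \<le> 3 * sqrt s / sqrt T / s * (K * sqrt s)"
      unfolding norm_mult using bound[OF that] s T by (intro mult_mono) auto
    also have "\<dots> = 3 * K / sqrt T * (sqrt s * sqrt s / s)" by (simp only: times_divide_eq_left times_divide_eq_right divide_divide_eq_left mult_ac)
    also have "\<dots> = 3 * K / sqrt T" using s by simp
    finally show ?thesis .
  qed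
  have "cmod (integral ?I r) \<le> integral ?I (\<lambda>s. 10 * K * P s + 1 / (2 * K * sqrt T) * ((cmod (G' s))\<^sup>2 / s))"
  proof (rule integral_norm_bound_integral)
    show "r integrable_on ?I" by (intro integrable_continuous_real rc)
    show "(\<lambda>s. 10 * K * P s + 1 / (2 * K * sqrt T) * ((cmod (G' s))\<^sup>2 / s)) integrable_on ?I"
      by (intro integrable_continuous_real continuous_on_add continuous_on_mult continuous_on_const Pc Nc)
    show "cmod (r s) \<le> 10 * K * P s + 1 / (2 * K * sqrt T) * ((cmod (G' s))\<^sup>2 / s)" if "s \<in> ?I" for s
      unfolding r_def using that by (intro remainder_le pos K bound) auto
  qed
  also have "\<dots> = 10 * K * integral ?I P + 1 / (2 * K * sqrt T) * integral ?I (\<lambda>s. (cmod (G' s))\<^sup>2 / s)"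
    by (subst integral_add) (simp_all only: integral_mult_right integrable_continuous_real Pc Nc continuous_on_mult continuous_on_const)
  also have "\<dots> \<le> 10 * K * (19 / sqrt T) + 1 / (2 * K * sqrt T) * K\<^sup>2"
    using K T by (intro add_mono mult_left_mono integral_P le energy) auto
  also have "\<dots> = 10 * K * (19 / sqrt T) + K / (2 * sqrt T)" using K by (simp add: power2_eq_square)
  also have "\<dots> \<le> 191 * K / sqrt T" using K T by (simp add: divide_simps)
  finally have "cmod (integral ?I r) \<le> 191 * K / sqrt T" .
  moreover have "cmod (integral ?I f) \<le> cmod (w T * G T) + cmod (w (1 / T) * G (1 / T)) + cmod (integral ?I r)"
    unfolding eq by (meson norm_triangle_ineq4 add_right_mono order_trans)
  ultimately have "cmod (integral ?I f) \<le> 3 * K / sqrt T + 3 * K / sqrt T + 191 * K / sqrt T"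
    using bd[of T] bd[of "1 / T"] le by fastforce
  also have "\<dots> = 197 * K / sqrt T" by (simp flip: add_divide_distrib)
  also have "\<dots> \<le> 200 * K / sqrt T" using K T by (intro divide_right_mono) auto
  finally show ?thesis unfolding f_def .
qed

end

section \<open>Reduction to the oscillatory integral\<close>

lemma cauchy_density_integral:
  assumes c: "c > 0"
  shows "integrable lborel (\<lambda>x::real. 1 / (c\<^sup>2 + x\<^sup>2))" "(LINT x|lborel. 1 / (c\<^sup>2 + x\<^sup>2)) = pi / c"
proof -
  have i: "integrable lborel (\<lambda>x::real. inverse (1 + x\<^sup>2))"
    using integrable_inverse_1_plus_square unfolding set_integrable_def by simp
  have v: "(LINT x|lborel. inverse (1 + x\<^sup>2)) = pi"
    using LBINT_inverse_1_plus_square by (simp add: interval_lebesgue_integral_def set_lebesgue_integral_def)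
  have eq: "1 / (c\<^sup>2 + x\<^sup>2) = inverse (1 + (0 + 1 / c * x)\<^sup>2) / c\<^sup>2" for x
  proof -
    have "1 + (0 + 1 / c * x)\<^sup>2 = (c\<^sup>2 + x\<^sup>2) / c\<^sup>2" using c by (simp add: power_divide add_divide_distrib)
    then show ?thesis using c by simp
  qed
  show "integrable lborel (\<lambda>x::real. 1 / (c\<^sup>2 + x\<^sup>2))"
    unfolding eq using lborel_integrable_real_affine[OF i, of "1 / c" 0] c by simp
  have "(LINT x|lborel. inverse (1 + x\<^sup>2)) = \<bar>1 / c\<bar> *\<^sub>R (LINT x|lborel. inverse (1 + (0 + 1 / c * x)\<^sup>2))"
    by (rule lborel_integral_real_affine) (use c in auto)
  then have "(LINT x|lborel. inverse (1 + (0 + 1 / c * x)\<^sup>2)) = c * pi"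
    using c v by (simp add: field_simps)
  then show "(LINT x|lborel. 1 / (c\<^sup>2 + x\<^sup>2)) = pi / c"
    unfolding eq using c by (simp add: power2_eq_square)
qed

text \<open>The optimal parameter is \<open>sqrt (M / Q)\<close>. For \<open>Q = 0\<close> the
  choice \<open>M / X\<close> would give \<open>2 * X \<le> X\<close>. Integrating a pointwise
  inequality with a free \<mu> and then applying this lemma replaces Cauchy-Schwarz.\<close>

lemma le_sqrt_mult_of_AMGM:
  fixes X Q M :: real
  assumes "\<And>\<mu>. \<mu> > 0 \<Longrightarrow> 2 * X \<le> \<mu> * Q + M / \<mu>" "Q \<ge> 0" "M > 0"
  shows "X \<le> sqrt (Q * M)"
proof (cases "Q = 0")
  case True
  show ?thesis
  proof (rule ccontr)
    assume "\<not> ?thesis"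
    then have "X > 0" using True by simp
    then show False using assms(1)[of "M / X"] assms(3) True by simp
  qed
next
  case False
  with assms have Q: "Q > 0" by simp
  have "2 * X \<le> sqrt (M / Q) * Q + M / sqrt (M / Q)" using assms Q by (intro assms(1)) auto
  also have "sqrt (M / Q) * Q = sqrt (Q * M)"
    using Q assms by (simp add: real_sqrt_divide real_sqrt_mult field_simps)
  also have "M / sqrt (M / Q) = sqrt (Q * M)"
    using Q assms by (simp add: real_sqrt_divide real_sqrt_mult field_simps)
  finally show ?thesis by simp
qed

text \<open>\<open>\<kappa>\<close> is \<open>\<i>\<close> for the transform itself and \<open>-\<i>\<close> after the reflection to negative frequencies.\<close>
locale weighted_pair =
  fixes f F F1 :: "real \<Rightarrow> complex" and \<kappa> :: complex and Q :: real
  assumes fc: "\<And>\<xi>. isCont f \<xi>" and F1c: "\<And>\<xi>. isCont F1 \<xi>"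
    and F_deriv: "\<And>\<xi>. (F has_vector_derivative F1 \<xi>) (at \<xi>)"
    and kappa: "cmod \<kappa> = 1"
    and F_eq: "\<And>\<xi>. F \<xi> = \<kappa> * of_real \<xi> * f \<xi>"
    and int: "integrable lborel (\<lambda>\<xi>. (cmod (f \<xi>))\<^sup>2 + (cmod (F \<xi>))\<^sup>2 + (cmod (F1 \<xi>))\<^sup>2)"
    and Q: "(LINT \<xi>|lborel. (cmod (f \<xi>))\<^sup>2 + (cmod (F \<xi>))\<^sup>2 + (cmod (F1 \<xi>))\<^sup>2) \<le> Q"
begin

definition \<rho> :: "real \<Rightarrow> real" where "\<rho> \<xi> = (cmod (f \<xi>))\<^sup>2 + (cmod (F \<xi>))\<^sup>2 + (cmod (F1 \<xi>))\<^sup>2"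

lemma Fc: "isCont F \<xi>"
  using F_deriv has_vector_derivative_continuous by blast

lemma rho: "\<rho> \<xi> \<ge> 0" "integrable lborel \<rho>" "(LINT \<xi>|lborel. \<rho> \<xi>) \<le> Q" "isCont \<rho> \<xi>"
  using int Q unfolding \<rho>_def[abs_def] by (auto intro!: continuous_intros fc Fc F1c)

lemma Q_nonneg: "Q \<ge> 0"
  using order_trans[OF Bochner_Integration.integral_nonneg rho(3)] rho(1) by blast

lemma integral_rho_le: "integral {a..b} \<rho> \<le> Q"
proof -
  have si: "set_integrable lborel {a..b} \<rho>"
    by (intro borel_integrable_atLeastAtMost' continuous_at_imp_continuous_on ballI rho)
  have "integral {a..b} \<rho> = (LINT \<xi>:{a..b}|lborel. \<rho> \<xi>)"
    by (rule set_borel_integral_eq_integral(2)[OF si, symmetric])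
  also have "\<dots> \<le> (LINT \<xi>|lborel. \<rho> \<xi>)"
    unfolding set_lebesgue_integral_def
    by (rule integral_mono) (use si rho(1,2) in \<open>auto simp: set_integrable_def indicator_def\<close>)
  finally show ?thesis using rho(3) by simp
qed

lemma integral_cmod_F1_le: "integral {a..b} (\<lambda>\<xi>. (cmod (F1 \<xi>))\<^sup>2) \<le> Q"
proof -
  have "integral {a..b} (\<lambda>\<xi>. (cmod (F1 \<xi>))\<^sup>2) \<le> integral {a..b} \<rho>"
    by (intro integral_le integrable_continuous_real continuous_at_imp_continuous_on ballI rho continuous_intros F1c)
       (simp add: \<rho>_def)
  then show ?thesis using integral_rho_le[of a b] by simp
qed

text \<open>\<open>F\<close> vanishes at 0, so |F|^2 is the integral of its derivative 2 Re(F conj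
  F'). The factor \<open>sqrt \<xi>\<close> is gained from |F| = s |f|, which makes |F| equal to
  \<open>sqrt s\<close> times the geometric mean of |f| and |F|.\<close>

lemma cmod_F_sq_le:
  assumes "\<xi> \<ge> 0"
  shows "(cmod (F \<xi>))\<^sup>2 \<le> sqrt \<xi> * Q"
proof -
  have F0: "F 0 = 0" by (simp add: F_eq)
  have "((\<lambda>s. F s \<bullet> F s) has_vector_derivative (F s \<bullet> F1 s + F1 s \<bullet> F s)) (at s within {0..\<xi>})" for s
    using has_vector_derivative_at_within[OF F_deriv[of s]]
    unfolding has_vector_derivative_def
    by (auto intro!: derivative_eq_intros simp: algebra_simps inner_commute)
  from fundamental_theorem_of_calculus[OF assms this]
  have I: "((\<lambda>s. F s \<bullet> F1 s + F1 s \<bullet> F s) has_integral F \<xi> \<bullet> F \<xi>) {0..\<xi>}" by (simp add: F0)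
  then have "(cmod (F \<xi>))\<^sup>2 = integral {0..\<xi>} (\<lambda>s. F s \<bullet> F1 s + F1 s \<bullet> F s)"
    by (simp add: integral_unique dot_square_norm)
  also have "\<dots> \<le> integral {0..\<xi>} (\<lambda>s. sqrt \<xi> * \<rho> s)"
  proof (rule integral_le)
    show "(\<lambda>s. F s \<bullet> F1 s + F1 s \<bullet> F s) integrable_on {0..\<xi>}" using I by blast
    show "(\<lambda>s. sqrt \<xi> * \<rho> s) integrable_on {0..\<xi>}"
      by (intro integrable_continuous_real continuous_at_imp_continuous_on ballI continuous_intros rho)
    fix s assume s: "s \<in> {0..\<xi>}"
    define p q r where "p = cmod (f s)" and "q = cmod (F s)" and "r = cmod (F1 s)"
    have nn: "p \<ge> 0" "q \<ge> 0" "r \<ge> 0" by (auto simp: p_def q_def r_def)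
    have q: "q = s * p" unfolding p_def q_def F_eq using s kappa by (simp add: norm_mult)
    \<comment> \<open>Since \<open>q = s * p\<close>, the square of \<open>q\<close> is
      \<open>s * (p * q)\<close>; now compare geometric and arithmetic means of \<open>p\<close> and
      \<open>q\<close>.\<close>
    have "2 * q \<le> sqrt s * (p + q)"
    proof -
      have "4 * (p * q) \<le> (p + q)\<^sup>2" using zero_le_power2[of "p - q"] by (simp add: power2_eq_square algebra_simps)
      then have "s * (4 * (p * q)) \<le> s * (p + q)\<^sup>2" using s by (intro mult_left_mono) auto
      then have "(2 * q)\<^sup>2 \<le> (sqrt s * (p + q))\<^sup>2"
        using s by (simp add: power_mult_distrib q) (simp add: power2_eq_square mult_ac)
      then show ?thesis by (rule power2_le_imp_le) (use nn s in auto)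
    qed
    also have "\<dots> \<le> sqrt \<xi> * (p + q)" using s nn by (intro mult_right_mono) auto
    finally have "2 * q * r \<le> sqrt \<xi> * ((p + q) * r)" using nn mult_right_mono by fastforce
    also have "\<dots> \<le> sqrt \<xi> * (p\<^sup>2 + q\<^sup>2 + r\<^sup>2)"
    proof (intro mult_left_mono)
      show "(p + q) * r \<le> p\<^sup>2 + q\<^sup>2 + r\<^sup>2"
        using sum_squares_bound[of p r] sum_squares_bound[of q r] zero_le_power2[of p] zero_le_power2[of q]
        by (simp only: distrib_right)
    qed (use assms in auto)
    finally show "F s \<bullet> F1 s + F1 s \<bullet> F s \<le> sqrt \<xi> * \<rho> s"
      using norm_cauchy_schwarz[of "F s" "F1 s"] by (simp add: inner_commute \<rho>_def p_def q_def r_def)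
  qed
  also have "\<dots> = sqrt \<xi> * integral {0..\<xi>} \<rho>" by simp
  also have "\<dots> \<le> sqrt \<xi> * Q" using assms by (intro mult_left_mono integral_rho_le) auto
  finally show ?thesis .
qed

section \<open>The intermediate frequencies on one half-line\<close>

text \<open>After \<xi> = s^2 the Jacobian \<open>2 * s\<close> and the factor
  \<open>1 / \<xi>\<close> hidden in \<open>f\<close> combine to \<open>2 / s\<close>, the form that
  \<open>van_der_Corput_sqrt\<close> expects, with \<open>K = sqrt (2 * Q)\<close>.\<close>

lemma half_line_bound:
  fixes x t T :: real
  assumes T: "T = \<bar>t\<bar>" "T \<ge> 1"
  shows "cmod (LINT \<xi>:{(1 / T)\<^sup>2..T\<^sup>2}|lborel. exp (\<i> * of_real (x * \<xi> + t * sqrt \<xi>)) * f \<xi>) \<le> 600 * sqrt Q / sqrt T"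
proof -
  interpret sqrt_phase x t T by unfold_locales (use T in auto)
  have Tp: "T > 0" "1 / T > 0" using T by auto
  have le: "1 / T \<le> T" using T by (metis Tp(1) divide_le_eq_1_pos order_trans)
  define u where "u \<xi> = exp (\<i> * of_real (x * \<xi> + t * sqrt \<xi>)) * f \<xi>" for \<xi>
  have uc: "continuous_on S u" for S
    unfolding u_def by (intro continuous_at_imp_continuous_on ballI continuous_intros fc isCont_real_sqrt)
  define G where "G s = F (s\<^sup>2)" for s
  define G' where "G' s = of_real (2 * s) * F1 (s\<^sup>2)" for s
  define J where "J = integral {1 / T..T} (\<lambda>s. exp (\<i> * of_real (x * s\<^sup>2 + t * s)) * G s / of_real s)"
  have "(LINT \<xi>:{(1 / T)\<^sup>2..T\<^sup>2}|lborel. u \<xi>) = integral {(1 / T)\<^sup>2..T\<^sup>2} u"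
    by (intro set_borel_integral_eq_integral borel_integrable_atLeastAtMost' uc)
  also have "\<dots> = integral {1 / T..T} (\<lambda>s. (2 * s) *\<^sub>R u (s\<^sup>2))"
    by (rule integral_square_substitution) (use Tp le uc in auto)
  also have "\<dots> = integral {1 / T..T} (\<lambda>s. (2 * cnj \<kappa>) * (exp (\<i> * of_real (x * s\<^sup>2 + t * s)) * G s / of_real s))"
  proof (rule integral_cong)
    fix s assume "s \<in> {1 / T..T}"
    then have s: "s > 0" using Tp by (simp, linarith)
    \<comment> \<open>Multiplication by \<open>cnj \<kappa>\<close> inverts \<open>\<kappa>\<close>
      and recovers \<open>\<xi> * f\<close> from \<open>F\<close>.\<close>
    have "cnj \<kappa> * \<kappa> = 1" using kappa complex_norm_square[of \<kappa>] by (simp add: mult.commute)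
    then have "cnj \<kappa> * F (s\<^sup>2) = of_real (s\<^sup>2) * f (s\<^sup>2)" by (simp add: F_eq flip: mult.assoc)
    then have "(2 * cnj \<kappa>) * (exp (\<i> * of_real (x * s\<^sup>2 + t * s)) * G s / of_real s) =
      2 * (exp (\<i> * of_real (x * s\<^sup>2 + t * s)) / of_real s) * (of_real (s\<^sup>2) * f (s\<^sup>2))"
      unfolding G_def by (simp add: field_simps)
    then show "(2 * s) *\<^sub>R u (s\<^sup>2) = (2 * cnj \<kappa>) * (exp (\<i> * of_real (x * s\<^sup>2 + t * s)) * G s / of_real s)"
      using s by (simp add: u_def scaleR_conv_of_real power2_eq_square)
  qed
  also have "\<dots> = 2 * cnj \<kappa> * J" unfolding J_def by (rule integral_mult_right)
  finally have "cmod (LINT \<xi>:{(1 / T)\<^sup>2..T\<^sup>2}|lborel. u \<xi>) = 2 * cmod J"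
    using kappa by (simp add: norm_mult)
  also have "cmod J \<le> 200 * sqrt (2 * Q) / sqrt T"
    unfolding J_def
  proof (rule van_der_Corput_sqrt)
    show "(G has_vector_derivative G' s) (at s within {1 / T..T})" for s
    proof -
      have "((F \<circ> (\<lambda>s. s\<^sup>2)) has_vector_derivative (2 * s) *\<^sub>R F1 (s\<^sup>2)) (at s)"
        by (rule vector_diff_chain_at) (auto intro!: derivative_eq_intros F_deriv simp: has_real_derivative_iff_has_vector_derivative[symmetric])
      then show ?thesis by (simp add: G_def[abs_def] G'_def comp_def scaleR_conv_of_real has_vector_derivative_at_within)
    qed
    have "isCont (\<lambda>s. F1 (s\<^sup>2)) s" for s by (rule isCont_o2[OF _ F1c]) (intro continuous_intros)
    then show "continuous_on {1 / T..T} G'"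
      unfolding G'_def by (intro continuous_at_imp_continuous_on ballI continuous_intros)
    show "cmod (G s) \<le> sqrt (2 * Q) * sqrt s" if "s \<in> {1 / T..T}" for s
    proof -
      have s: "s > 0" using Tp that by (simp, linarith)
      have "(cmod (G s))\<^sup>2 \<le> s * Q" using cmod_F_sq_le[of "s\<^sup>2"] s by (simp add: G_def)
      also have "\<dots> \<le> 2 * Q * s" using s Q_nonneg by simp
      finally have "cmod (G s) \<le> sqrt (2 * Q * s)" by (rule real_le_rsqrt)
      then show ?thesis by (simp add: real_sqrt_mult)
    qed
    show "integral {1 / T..T} (\<lambda>s. (cmod (G' s))\<^sup>2 / s) \<le> (sqrt (2 * Q))\<^sup>2"
    proof -
      \<comment> \<open>Here |G'(s)|^2 / s is 4 s |F1(s^2)|^2, twice the integrand after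
        substitution; hence the 2 in \<open>K\<^sup>2 = 2 * Q\<close>.\<close>
      have "integral {1 / T..T} (\<lambda>s. (cmod (G' s))\<^sup>2 / s) = integral {1 / T..T} (\<lambda>s. 2 * ((2 * s) *\<^sub>R (cmod (F1 (s\<^sup>2)))\<^sup>2))"
      proof (rule integral_cong)
        fix s assume "s \<in> {1 / T..T}"
        then have "s > 0" using Tp by (simp, linarith)
        then show "(cmod (G' s))\<^sup>2 / s = 2 * ((2 * s) *\<^sub>R (cmod (F1 (s\<^sup>2)))\<^sup>2)"
          by (simp add: G'_def norm_mult power_mult_distrib) (simp add: power2_eq_square)
      qed
      also have "\<dots> = 2 * integral {(1 / T)\<^sup>2..T\<^sup>2} (\<lambda>\<xi>. (cmod (F1 \<xi>))\<^sup>2)"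
        unfolding integral_mult_right
        by (subst integral_square_substitution) (use Tp le F1c in \<open>auto intro!: continuous_at_imp_continuous_on continuous_intros\<close>)
      also have "\<dots> \<le> 2 * Q" using integral_cmod_F1_le by simp
      finally show ?thesis using Q_nonneg by simp
    qed
  qed (use Q_nonneg in auto)
  finally have "cmod (LINT \<xi>:{(1 / T)\<^sup>2..T\<^sup>2}|lborel. u \<xi>) \<le> 400 * (sqrt 2 * sqrt Q) / sqrt T"
    by (simp add: real_sqrt_mult)
  also have "\<dots> \<le> 400 * (3 / 2 * sqrt Q) / sqrt T"
    using Q_nonneg Tp by (intro divide_right_mono mult_left_mono mult_right_mono real_le_lsqrt) (auto simp: power2_eq_square)
  finally show ?thesis unfolding u_def by simp
qed

text \<open>Negative frequencies become an instance of the positive half-line with the same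
  \<open>Q\<close>.\<close>

lemma reflect: "weighted_pair (\<lambda>\<xi>. f (- \<xi>)) (\<lambda>\<xi>. F (- \<xi>)) (\<lambda>\<xi>. - F1 (- \<xi>)) (- \<kappa>) Q"
proof
  have c: "isCont (\<lambda>\<xi>. g (- \<xi>)) \<xi>" if "\<And>\<xi>. isCont g \<xi>" for g :: "real \<Rightarrow> complex" and \<xi>
    by (rule isCont_o2[OF _ that]) (intro continuous_intros)
  show "isCont (\<lambda>\<xi>. f (- \<xi>)) \<xi>" "isCont (\<lambda>\<xi>. - F1 (- \<xi>)) \<xi>" for \<xi>
    by (intro continuous_intros c fc F1c)+
  show "((\<lambda>\<xi>. F (- \<xi>)) has_vector_derivative - F1 (- \<xi>)) (at \<xi>)" for \<xi>
  proof -
    have "((F \<circ> uminus) has_vector_derivative (- 1) *\<^sub>R F1 (- \<xi>)) (at \<xi>)"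
      by (rule vector_diff_chain_at) (auto intro!: derivative_eq_intros F_deriv simp: has_real_derivative_iff_has_vector_derivative[symmetric])
    then show ?thesis by (simp add: comp_def)
  qed
  show "cmod (- \<kappa>) = 1" by (simp add: kappa)
  show "F (- \<xi>) = - \<kappa> * of_real \<xi> * f (- \<xi>)" for \<xi> by (simp add: F_eq)
  show "integrable lborel (\<lambda>\<xi>. (cmod (f (- \<xi>)))\<^sup>2 + (cmod (F (- \<xi>)))\<^sup>2 + (cmod (- F1 (- \<xi>)))\<^sup>2)"
    using lborel_integrable_real_affine[OF int, of "- 1" 0] by simp
  show "(LINT \<xi>|lborel. (cmod (f (- \<xi>)))\<^sup>2 + (cmod (F (- \<xi>)))\<^sup>2 + (cmod (- F1 (- \<xi>)))\<^sup>2) \<le> Q"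
    using Q lborel_integral_real_affine[of "- 1" "\<lambda>\<xi>. (cmod (f \<xi>))\<^sup>2 + (cmod (F \<xi>))\<^sup>2 + (cmod (F1 \<xi>))\<^sup>2" 0] by simp
qed

section \<open>Low and high frequencies, and assembly of the dispersive bound\<close>

lemma f_measurable [measurable]: "f \<in> borel_measurable borel"
  using fc by (intro borel_measurable_continuous_onI) (simp add: continuous_at_imp_continuous_on)

text \<open>AM-GM with the weight \<open>1 + \<xi>\<^sup>2\<close>, whose product with |f|^2 is
  |f|^2 + |F|^2. Writing \<open>1\<^sup>2\<close> matches \<open>cauchy_density_integral\<close> at
  \<open>c = 1\<close>.\<close>

lemma cmod_f_AMGM:
  assumes "\<mu> > 0"
  shows "2 * cmod (f \<xi>) \<le> \<mu> * \<rho> \<xi> + 1 / (1\<^sup>2 + \<xi>\<^sup>2) / \<mu>"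
proof -
  define m where "m = 1 + \<xi>\<^sup>2"
  have m: "m > 0" by (simp add: m_def add_pos_nonneg)
  have F: "(cmod (F \<xi>))\<^sup>2 = \<xi>\<^sup>2 * (cmod (f \<xi>))\<^sup>2" unfolding F_eq using kappa by (simp add: norm_mult power_mult_distrib)
  have "2 * (\<mu> * m * cmod (f \<xi>)) * 1 \<le> (\<mu> * m * cmod (f \<xi>))\<^sup>2 + 1\<^sup>2" by (rule sum_squares_bound)
  then have "2 * cmod (f \<xi>) \<le> \<mu> * (m * (cmod (f \<xi>))\<^sup>2) + 1 / (m * \<mu>)"
    using assms m by (simp add: field_simps power2_eq_square)
  also have "m * (cmod (f \<xi>))\<^sup>2 \<le> \<rho> \<xi>" unfolding \<rho>_def F m_def by (simp add: algebra_simps)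
  finally show ?thesis using assms by (simp add: m_def)
qed

lemma f_integrable: "integrable lborel f"
proof (rule Bochner_Integration.integrable_bound)
  show "integrable lborel (\<lambda>\<xi>. 1 * \<rho> \<xi> + 1 / (1\<^sup>2 + \<xi>\<^sup>2) / 1)"
    using rho(2) cauchy_density_integral(1)[of 1] by simp
  show "AE \<xi> in lborel. norm (f \<xi>) \<le> norm (1 * \<rho> \<xi> + 1 / (1\<^sup>2 + \<xi>\<^sup>2) / 1)"
    using cmod_f_AMGM[of 1] rho(1) by (intro AE_I2) (smt (verit) norm_ge_zero real_norm_def)
qed simp

text \<open>Cauchy-Schwarz on \<open>B\<close> against the weight
  \<open>1 / (1 + \<xi>\<^sup>2)\<close>. The majorant \<open>h\<close> stands in for the
  restriction of the weight to \<open>B\<close>, so that explicit whole-line integrals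
  suffice.\<close>

lemma set_integral_cmod_f_le:
  assumes B[measurable]: "B \<in> sets borel" and M: "M > 0"
    and h: "integrable lborel h" "(LINT \<xi>|lborel. h \<xi>) \<le> M" "\<And>\<xi>. h \<xi> \<ge> 0"
    and le: "\<And>\<xi>. \<xi> \<in> B \<Longrightarrow> 1 / (1\<^sup>2 + \<xi>\<^sup>2) \<le> h \<xi>"
  shows "(LINT \<xi>:B|lborel. cmod (f \<xi>)) \<le> sqrt (Q * M)"
proof (rule le_sqrt_mult_of_AMGM[OF _ Q_nonneg M])
  fix \<mu> :: real assume l: "\<mu> > 0"
  have "2 * (LINT \<xi>:B|lborel. cmod (f \<xi>)) = (LINT \<xi>|lborel. 2 * (indicator B \<xi> *\<^sub>R cmod (f \<xi>)))"
    unfolding set_lebesgue_integral_def by (simp only: integral_mult_right_zero)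
  also have "\<dots> \<le> (LINT \<xi>|lborel. \<mu> * \<rho> \<xi> + h \<xi> / \<mu>)"
  proof (rule integral_mono)
    show "integrable lborel (\<lambda>\<xi>. 2 * (indicator B \<xi> *\<^sub>R cmod (f \<xi>)))"
      by (intro integrable_mult_right integrable_mult_indicator integrable_norm f_integrable) simp
    show "integrable lborel (\<lambda>\<xi>. \<mu> * \<rho> \<xi> + h \<xi> / \<mu>)" using rho(2) h by simp
    show "2 * (indicator B \<xi> *\<^sub>R cmod (f \<xi>)) \<le> \<mu> * \<rho> \<xi> + h \<xi> / \<mu>" for \<xi>
    proof (cases "\<xi> \<in> B")
      case True
      have "1 / (1\<^sup>2 + \<xi>\<^sup>2) / \<mu> \<le> h \<xi> / \<mu>" using le[OF True] l by (intro divide_right_mono) auto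
      then show ?thesis using True cmod_f_AMGM[OF l, of \<xi>] by simp
    qed (use l rho(1) h(3) in auto)
  qed
  also have "\<dots> = \<mu> * (LINT \<xi>|lborel. \<rho> \<xi>) + (LINT \<xi>|lborel. h \<xi>) / \<mu>"
    using rho(2) h by simp
  also have "\<dots> \<le> \<mu> * Q + M / \<mu>" using l rho(3) h by (intro add_mono mult_left_mono divide_right_mono) auto
  finally show "2 * (LINT \<xi>:B|lborel. cmod (f \<xi>)) \<le> \<mu> * Q + M / \<mu>" .
qed

lemma integral_cmod_f_le: "(LINT \<xi>|lborel. cmod (f \<xi>)) \<le> 2 * sqrt Q"
proof -
  have "(LINT \<xi>:UNIV|lborel. cmod (f \<xi>)) \<le> sqrt (Q * 4)"
    by (rule set_integral_cmod_f_le[where h="\<lambda>\<xi>. 1 / (1\<^sup>2 + \<xi>\<^sup>2)"])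
       (use cauchy_density_integral[of 1] pi_less_4 in auto)
  then show ?thesis by (simp add: set_lebesgue_integral_def real_sqrt_mult)
qed

text \<open>With \<open>a = 1 / T\<^sup>2\<close> and \<open>b = T\<^sup>2\<close>, the first
  summand of the majorant is at least 1 where |\<xi>| \<le> a, and the second dominates the weight
  where |\<xi>| \<ge> b. As \<open>a = 1 / b\<close>, their integrals add up to
  \<open>4 * pi / b\<close>.\<close>

lemma tails_le:
  assumes T: "T \<ge> 1"
  shows "(LINT \<xi>:- ({(1 / T)\<^sup>2..T\<^sup>2} \<union> {- T\<^sup>2..- (1 / T)\<^sup>2})|lborel. cmod (f \<xi>)) \<le> 4 * sqrt Q / T"
proof -
  define a where "a = (1 / T)\<^sup>2"
  define b where "b = T\<^sup>2"
  have ab: "a > 0" "b > 0" "a = 1 / b" using T by (auto simp: a_def b_def power_divide)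
  have "(LINT \<xi>:- ({a..b} \<union> {- b..- a})|lborel. cmod (f \<xi>)) \<le> sqrt (Q * (16 / b))"
  proof (rule set_integral_cmod_f_le[where h="\<lambda>\<xi>. 2 * a\<^sup>2 * (1 / (a\<^sup>2 + \<xi>\<^sup>2)) + 2 * (1 / (b\<^sup>2 + \<xi>\<^sup>2))"])
    show "integrable lborel (\<lambda>\<xi>. 2 * a\<^sup>2 * (1 / (a\<^sup>2 + \<xi>\<^sup>2)) + 2 * (1 / (b\<^sup>2 + \<xi>\<^sup>2)))"
      by (intro Bochner_Integration.integrable_add integrable_mult_right cauchy_density_integral ab)
    have "(LINT \<xi>|lborel. 2 * a\<^sup>2 * (1 / (a\<^sup>2 + \<xi>\<^sup>2)) + 2 * (1 / (b\<^sup>2 + \<xi>\<^sup>2))) = 2 * a\<^sup>2 * (pi / a) + 2 * (pi / b)"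
      using ab by (subst Bochner_Integration.integral_add)
        (intro integrable_mult_right cauchy_density_integral, simp, intro integrable_mult_right cauchy_density_integral, simp,
         simp only: integral_mult_right_zero cauchy_density_integral)
    also have "\<dots> = 4 * pi / b" using ab by (simp add: power2_eq_square)
    also have "\<dots> \<le> 16 / b" using ab pi_less_4 by (intro divide_right_mono) auto
    finally show "(LINT \<xi>|lborel. 2 * a\<^sup>2 * (1 / (a\<^sup>2 + \<xi>\<^sup>2)) + 2 * (1 / (b\<^sup>2 + \<xi>\<^sup>2))) \<le> 16 / b" .
    fix \<xi> assume "\<xi> \<in> - ({a..b} \<union> {- b..- a})"
    then consider "\<bar>\<xi>\<bar> \<le> a" | "b \<le> \<bar>\<xi>\<bar>" by fastforce
    then show "1 / (1\<^sup>2 + \<xi>\<^sup>2) \<le> 2 * a\<^sup>2 * (1 / (a\<^sup>2 + \<xi>\<^sup>2)) + 2 * (1 / (b\<^sup>2 + \<xi>\<^sup>2))"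
    proof cases
      case 1
      then have "\<xi>\<^sup>2 \<le> a\<^sup>2" using power_mono[of "\<bar>\<xi>\<bar>" a 2] by simp
      then have "1 \<le> 2 * a\<^sup>2 * (1 / (a\<^sup>2 + \<xi>\<^sup>2))" using ab by (simp add: add_pos_nonneg)
      moreover have "1 / (1\<^sup>2 + \<xi>\<^sup>2) \<le> 1" by (simp add: add_pos_nonneg)
      moreover have "0 \<le> 2 * (1 / (b\<^sup>2 + \<xi>\<^sup>2))" by simp
      ultimately show ?thesis by linarith
    next
      case 2
      then have "b\<^sup>2 \<le> \<xi>\<^sup>2" using power_mono[of b "\<bar>\<xi>\<bar>" 2] ab by simp
      moreover have "b\<^sup>2 > 0" using ab by simp
      ultimately have q: "b\<^sup>2 + \<xi>\<^sup>2 \<le> 2 * (1\<^sup>2 + \<xi>\<^sup>2)" "b\<^sup>2 + \<xi>\<^sup>2 > 0" "1\<^sup>2 + \<xi>\<^sup>2 > 0"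
        by (auto intro: add_pos_nonneg)
      have "1 / p \<le> 2 * (1 / q)" if "q \<le> 2 * p" "q > 0" "p > 0" for p q :: real
        using that by (simp add: field_simps)
      from this[OF q] have "1 / (1\<^sup>2 + \<xi>\<^sup>2) \<le> 2 * (1 / (b\<^sup>2 + \<xi>\<^sup>2))" .
      moreover have "0 \<le> 2 * a\<^sup>2 * (1 / (a\<^sup>2 + \<xi>\<^sup>2))" by simp
      ultimately show ?thesis by linarith
    qed
  qed (use ab in auto)
  also have "sqrt (Q * (16 / b)) = 4 * sqrt Q / T"
    using T by (simp add: b_def real_sqrt_mult real_sqrt_divide)
  finally show ?thesis unfolding a_def b_def .
qed

text \<open>For |t| \<le> 1 the absolute integral is enough. Otherwise the pieces give 4 + 600 + 600
  = 1204 over \<open>sqrt T\<close>, and passing to \<open>sqrt (1 + T)\<close> costs a factor 2,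
  leaving room below 3000.\<close>

lemma dispersive_bound:
  fixes x t :: real
  shows "cmod (LINT \<xi>|lborel. exp (\<i> * of_real (x * \<xi> + t * sqrt \<bar>\<xi>\<bar>)) * f \<xi>) \<le> 3000 * sqrt Q * (1 + \<bar>t\<bar>) powr (- 1 / 2)"
proof -
  define u where "u \<xi> = exp (\<i> * of_real (x * \<xi> + t * sqrt \<bar>\<xi>\<bar>)) * f \<xi>" for \<xi>
  have um[measurable]: "u \<in> borel_measurable borel" unfolding u_def by measurable
  have nu: "cmod (u \<xi>) = cmod (f \<xi>)" for \<xi> by (simp only: u_def norm_mult norm_exp_i_times mult_1)
  have ui: "integrable lborel u"
    by (rule Bochner_Integration.integrable_bound[OF f_integrable]) (auto simp: nu)
  have pw: "(1 + \<bar>t\<bar>) powr (- 1 / 2) = 1 / sqrt (1 + \<bar>t\<bar>)"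
    using powr_minus_divide[of "1 + \<bar>t\<bar>" "1 / 2"] by (simp add: powr_half_sqrt)
  show ?thesis
  proof (cases "\<bar>t\<bar> \<le> 1")
    case True
    have "cmod (LINT \<xi>|lborel. u \<xi>) \<le> (LINT \<xi>|lborel. cmod (u \<xi>))" by (rule integral_norm_bound)
    also have "\<dots> \<le> 2 * sqrt Q" unfolding nu by (rule integral_cmod_f_le)
    also have "\<dots> \<le> 3000 * sqrt Q * (1 / sqrt (1 + \<bar>t\<bar>))"
    proof -
      have "sqrt (1 + \<bar>t\<bar>) \<le> sqrt 4" using True by (intro real_sqrt_le_mono) auto
      then have "1 / 2 \<le> 1 / sqrt (1 + \<bar>t\<bar>)" by (intro divide_left_mono) auto
      then have "3000 * sqrt Q * (1 / 2) \<le> 3000 * sqrt Q * (1 / sqrt (1 + \<bar>t\<bar>))"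
        using Q_nonneg by (intro mult_left_mono) auto
      moreover have "2 * sqrt Q \<le> 3000 * sqrt Q * (1 / 2)" using Q_nonneg by simp
      ultimately show ?thesis by linarith
    qed
    finally show ?thesis unfolding u_def pw .
  next
    case False
    define T where "T = \<bar>t\<bar>"
    have T: "T \<ge> 1" using False by (simp add: T_def)
    define A where "A = {(1 / T)\<^sup>2..T\<^sup>2}"
    define B where "B = {- T\<^sup>2..- (1 / T)\<^sup>2}"
    have AB[measurable]: "A \<in> sets borel" "B \<in> sets borel" by (auto simp: A_def B_def)
    have pos: "(1 / T)\<^sup>2 > 0" using T by simp
    have disj: "\<xi> \<notin> A \<or> \<xi> \<notin> B" for \<xi> using pos unfolding A_def B_def atLeastAtMost_iff by linarith
    have absA: "\<bar>\<xi>\<bar> = \<xi>" if "\<xi> \<in> A" for \<xi> using pos that unfolding A_def atLeastAtMost_iff by linarith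
    have si: "integrable lborel (\<lambda>\<xi>. indicator S \<xi> *\<^sub>R u \<xi>)" if "S \<in> sets borel" for S
      using integrable_mult_indicator[of S lborel u] that ui by simp
    have "(LINT \<xi>|lborel. u \<xi>) = (LINT \<xi>|lborel. indicator (- (A \<union> B)) \<xi> *\<^sub>R u \<xi> + (indicator A \<xi> *\<^sub>R u \<xi> + indicator B \<xi> *\<^sub>R u \<xi>))"
      using disj by (intro Bochner_Integration.integral_cong) (auto simp: indicator_def)
    also have "\<dots> = (LINT \<xi>:- (A \<union> B)|lborel. u \<xi>) + ((LINT \<xi>:A|lborel. u \<xi>) + (LINT \<xi>:B|lborel. u \<xi>))"
      unfolding set_lebesgue_integral_def
      by (subst Bochner_Integration.integral_add, (intro si Bochner_Integration.integrable_add; measurable)+)+ simp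
    finally have split: "cmod (LINT \<xi>|lborel. u \<xi>) \<le> cmod (LINT \<xi>:- (A \<union> B)|lborel. u \<xi>) + (cmod (LINT \<xi>:A|lborel. u \<xi>) + cmod (LINT \<xi>:B|lborel. u \<xi>))"
      by (metis (no_types, lifting) add_left_mono norm_triangle_ineq order_trans)
    have "cmod (LINT \<xi>:- (A \<union> B)|lborel. u \<xi>) \<le> (LINT \<xi>:- (A \<union> B)|lborel. cmod (f \<xi>))"
      unfolding set_lebesgue_integral_def
      by (rule order_trans[OF integral_norm_bound]) (simp add: nu)
    also have "\<dots> \<le> 4 * sqrt Q / T" unfolding A_def B_def by (rule tails_le[OF T])
    also have "\<dots> \<le> 4 * sqrt Q / sqrt T"
    proof (intro divide_left_mono)
      show "sqrt T \<le> T" using T by (intro real_le_lsqrt) (auto simp: power2_eq_square)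
    qed (use T Q_nonneg in auto)
    finally have 1: "cmod (LINT \<xi>:- (A \<union> B)|lborel. u \<xi>) \<le> 4 * sqrt Q / sqrt T" .
    have "(LINT \<xi>:A|lborel. u \<xi>) = (LINT \<xi>:A|lborel. exp (\<i> * of_real (x * \<xi> + t * sqrt \<xi>)) * f \<xi>)"
      by (rule set_lebesgue_integral_cong) (use absA in \<open>auto simp: u_def A_def[symmetric]\<close>)
    then have 2: "cmod (LINT \<xi>:A|lborel. u \<xi>) \<le> 600 * sqrt Q / sqrt T"
      using half_line_bound[OF T_def T, of x] by (simp add: A_def)
    \<comment> \<open>The modulus in the phase is even, so reflection only changes the sign of
      \<open>x\<close>, and the half-line bound is uniform in \<open>x\<close>.\<close>
    have "(LINT \<xi>:B|lborel. u \<xi>) = (LINT \<xi>:A|lborel. u (- \<xi>))"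
      by (subst set_integral_reflect) (auto simp: A_def B_def intro!: arg_cong[where f="\<lambda>S. set_lebesgue_integral lborel S _"])
    also have "\<dots> = (LINT \<xi>:A|lborel. exp (\<i> * of_real ((- x) * \<xi> + t * sqrt \<xi>)) * f (- \<xi>))"
      by (rule set_lebesgue_integral_cong) (use absA in \<open>auto simp: u_def A_def[symmetric]\<close>)
    finally have 3: "cmod (LINT \<xi>:B|lborel. u \<xi>) \<le> 600 * sqrt Q / sqrt T"
      using weighted_pair.half_line_bound[OF reflect T_def T, of "- x"] by (simp add: A_def)
    have "cmod (LINT \<xi>|lborel. u \<xi>) \<le> 4 * sqrt Q / sqrt T + (600 * sqrt Q / sqrt T + 600 * sqrt Q / sqrt T)"
      using split 1 2 3 by linarith
    also have "\<dots> = 1204 * sqrt Q / sqrt T" by (simp flip: add_divide_distrib)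
    also have "\<dots> \<le> 1204 * sqrt Q * (2 / sqrt (1 + T))"
    proof -
      have "sqrt (1 + T) \<le> sqrt (4 * T)" using T by (intro real_sqrt_le_mono) auto
      then have "1 / sqrt T \<le> 2 / sqrt (1 + T)" using T by (simp add: real_sqrt_mult field_simps)
      then have "1204 * sqrt Q * (1 / sqrt T) \<le> 1204 * sqrt Q * (2 / sqrt (1 + T))"
        using Q_nonneg by (intro mult_left_mono) auto
      then show ?thesis by simp
    qed
    also have "\<dots> \<le> 3000 * sqrt Q * (1 / sqrt (1 + T))"
      using Q_nonneg T by (simp add: divide_right_mono)
    finally show ?thesis unfolding u_def pw T_def .
  qed
qed

end

section \<open>The Fourier transform\<close>

lemma cmod_exp_minus_i [simp]: "cmod (exp (- (\<i> * of_real r))) = 1"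
  using norm_exp_i_times[of "- r"] by (simp del: norm_exp_i_times)

text \<open>A chord is no longer than its arc. This gives the integrable majorant for the difference
  quotients of a transform.\<close>

lemma cmod_exp_i_diff_le: "cmod (exp (\<i> * of_real a) - exp (\<i> * of_real b)) \<le> \<bar>a - b\<bar>"
proof -
  have "exp (\<i> * of_real a) - exp (\<i> * of_real b) = exp (\<i> * of_real b) * (exp (\<i> * of_real (a - b)) - 1)"
    by (simp add: right_diff_distrib mult_exp_exp)
  then have "cmod (exp (\<i> * of_real a) - exp (\<i> * of_real b)) = 2 * \<bar>sin ((a - b) / 2)\<bar>"
    by (simp only: norm_mult norm_exp_i_times dist_exp_i_1)
  also have "\<dots> \<le> 2 * \<bar>(a - b) / 2\<bar>" by (intro mult_left_mono abs_sin_x_le_abs_x) auto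
  finally show ?thesis by simp
qed

lemma cmod_exp_minus_i_diff_le: "cmod (exp (- (\<i> * of_real a)) - exp (- (\<i> * of_real b))) \<le> \<bar>a - b\<bar>"
  using cmod_exp_i_diff_le[of "- a" "- b"] by simp

lemma integrable_exp_mult:
  assumes "integrable lborel g"
  shows "integrable lborel (\<lambda>x. exp (- (\<i> * of_real (x * \<xi>))) * g x)"
proof (rule Bochner_Integration.integrable_bound[OF assms])
  show "(\<lambda>x. exp (- (\<i> * of_real (x * \<xi>))) * g x) \<in> borel_measurable lborel"
    using borel_measurable_integrable[OF assms] by measurable
qed (simp add: norm_mult)

lemma isCont_fourier:
  assumes g: "integrable lborel g"
  shows "isCont (fourier g) \<xi>"
  unfolding continuous_at_sequentially
proof safe
  fix X assume X: "X \<longlonglongrightarrow> \<xi>"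
  have [measurable]: "g \<in> borel_measurable borel" using borel_measurable_integrable[OF g] by simp
  show "(fourier g \<circ> X) \<longlonglongrightarrow> fourier g \<xi>"
    unfolding comp_def fourier_def
  proof (rule integral_dominated_convergence[where w="\<lambda>x. cmod (g x)"])
    show "AE x in lborel. (\<lambda>n. exp (- (\<i> * of_real (x * X n))) * g x) \<longlonglongrightarrow> exp (- (\<i> * of_real (x * \<xi>))) * g x"
      by (intro AE_I2 tendsto_intros X)
  qed (use g in \<open>auto simp: norm_mult\<close>)
qed

lemma cmod_fourier_le: "cmod (fourier g \<xi>) \<le> (LINT x|lborel. cmod (g x))"
  unfolding fourier_def by (rule order_trans[OF integral_norm_bound]) (simp add: norm_mult)

lemma has_vector_derivative_iff_tendsto_quotient:
  fixes f :: "real \<Rightarrow> complex"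
  shows "(f has_vector_derivative d) (at x) \<longleftrightarrow> ((\<lambda>y. (1 / (y - x)) *\<^sub>R (f y - f x)) \<longlongrightarrow> d) (at x)"
proof -
  have *: "norm (f y - f x - (y - x) *\<^sub>R d) / norm (y - x) = norm ((1 / (y - x)) *\<^sub>R (f y - f x) - d)" if "y \<noteq> x" for y
  proof -
    have "(1 / (y - x)) *\<^sub>R (f y - f x) - d = (1 / (y - x)) *\<^sub>R (f y - f x - (y - x) *\<^sub>R d)"
      using that by (simp add: scaleR_diff_right)
    then show ?thesis by (simp add: divide_inverse abs_inverse)
  qed
  have "(f has_vector_derivative d) (at x) \<longleftrightarrow> ((\<lambda>y. norm (f y - f x - (y - x) *\<^sub>R d) / norm (y - x)) \<longlongrightarrow> 0) (at x)"
    unfolding has_vector_derivative_def has_derivative_iff_norm by (simp add: bounded_linear_scaleR_left)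
  also have "\<dots> \<longleftrightarrow> ((\<lambda>y. norm ((1 / (y - x)) *\<^sub>R (f y - f x) - d)) \<longlongrightarrow> 0) (at x)"
    by (rule filterlim_cong[OF refl refl]) (unfold eventually_at_filter, intro always_eventually allI impI *)
  also have "\<dots> \<longleftrightarrow> ((\<lambda>y. (1 / (y - x)) *\<^sub>R (f y - f x)) \<longlongrightarrow> d) (at x)"
    by (simp add: tendsto_norm_zero_iff LIM_zero_iff)
  finally show ?thesis .
qed

text \<open>Dominated convergence along sequences of difference quotients, with majorant |x
  g(x)|.\<close>

lemma fourier_has_vector_derivative:
  assumes g: "integrable lborel g" and xg: "integrable lborel (\<lambda>x. of_real x * g x)"
  shows "(fourier g has_vector_derivative fourier (\<lambda>x. - \<i> * (of_real x * g x)) \<xi>) (at \<xi>)"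
proof -
  have [measurable]: "g \<in> borel_measurable borel" using borel_measurable_integrable[OF g] by simp
  have "((\<lambda>y. (1 / (y - \<xi>)) *\<^sub>R (fourier g y - fourier g \<xi>)) \<longlongrightarrow> fourier (\<lambda>x. - \<i> * (of_real x * g x)) \<xi>) (at \<xi>)"
    unfolding tendsto_at_iff_sequentially
  proof (intro allI impI)
    fix X assume X1: "\<forall>i. X i \<in> UNIV - {\<xi>}" and X2: "X \<longlonglongrightarrow> \<xi>"
    have eq: "(1 / (X n - \<xi>)) *\<^sub>R (fourier g (X n) - fourier g \<xi>) =
        (LINT x|lborel. ((1 / (X n - \<xi>)) *\<^sub>R (exp (- (\<i> * of_real (x * X n))) - exp (- (\<i> * of_real (x * \<xi>))))) * g x)" for n
      unfolding fourier_def Bochner_Integration.integral_diff[OF integrable_exp_mult[OF g] integrable_exp_mult[OF g], symmetric]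
      by (subst integral_scaleR_right[symmetric]) (simp only: left_diff_distrib mult_scaleR_left)
    show "((\<lambda>y. (1 / (y - \<xi>)) *\<^sub>R (fourier g y - fourier g \<xi>)) \<circ> X) \<longlonglongrightarrow> fourier (\<lambda>x. - \<i> * (of_real x * g x)) \<xi>"
      unfolding comp_def eq unfolding fourier_def
    proof (rule integral_dominated_convergence[where w="\<lambda>x. cmod (of_real x * g x)"])
      show "integrable lborel (\<lambda>x. cmod (of_real x * g x))" using xg by simp
      show "AE x in lborel. (\<lambda>n. (1 / (X n - \<xi>)) *\<^sub>R (exp (- (\<i> * of_real (x * X n))) - exp (- (\<i> * of_real (x * \<xi>)))) * g x)
          \<longlonglongrightarrow> exp (- (\<i> * of_real (x * \<xi>))) * (- \<i> * (of_real x * g x))"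
      proof (rule AE_I2)
        fix x
        have "((\<lambda>z. exp (- (\<i> * (of_real x * z)))) has_field_derivative exp (- (\<i> * (of_real x * of_real \<xi>))) * (- \<i> * of_real x)) (at (of_real \<xi>))"
          by (auto intro!: derivative_eq_intros)
        then have "((\<lambda>y. exp (- (\<i> * (of_real x * of_real y)))) has_vector_derivative exp (- (\<i> * (of_real x * of_real \<xi>))) * (- \<i> * of_real x)) (at \<xi>)"
          by (rule has_vector_derivative_real_field)
        then have "((\<lambda>y. (1 / (y - \<xi>)) *\<^sub>R (exp (- (\<i> * (of_real x * of_real y))) - exp (- (\<i> * (of_real x * of_real \<xi>))))) \<longlongrightarrow> exp (- (\<i> * (of_real x * of_real \<xi>))) * (- \<i> * of_real x)) (at \<xi>)"
          unfolding has_vector_derivative_iff_tendsto_quotient .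
        then have "(\<lambda>n. (1 / (X n - \<xi>)) *\<^sub>R (exp (- (\<i> * of_real (x * X n))) - exp (- (\<i> * of_real (x * \<xi>)))))
          \<longlonglongrightarrow> exp (- (\<i> * of_real (x * \<xi>))) * (- \<i> * of_real x)"
          using X1 X2 unfolding tendsto_at_iff_sequentially by (simp add: comp_def)
        from tendsto_mult_right[OF this, of "g x"]
        show "(\<lambda>n. (1 / (X n - \<xi>)) *\<^sub>R (exp (- (\<i> * of_real (x * X n))) - exp (- (\<i> * of_real (x * \<xi>)))) * g x)
          \<longlonglongrightarrow> exp (- (\<i> * of_real (x * \<xi>))) * (- \<i> * (of_real x * g x))" by (simp add: mult_ac)
      qed
      show "AE x in lborel. norm ((1 / (X n - \<xi>)) *\<^sub>R (exp (- (\<i> * of_real (x * X n))) - exp (- (\<i> * of_real (x * \<xi>)))) * g x)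
         \<le> cmod (of_real x * g x)" for n
      proof (rule AE_I2)
        fix x
        have "cmod (exp (- (\<i> * of_real (x * X n))) - exp (- (\<i> * of_real (x * \<xi>)))) \<le> \<bar>x * X n - x * \<xi>\<bar>"
          by (rule cmod_exp_minus_i_diff_le)
        also have "\<dots> = \<bar>x\<bar> * \<bar>X n - \<xi>\<bar>" by (simp flip: abs_mult right_diff_distrib)
        finally have "cmod (exp (- (\<i> * of_real (x * X n))) - exp (- (\<i> * of_real (x * \<xi>)))) / \<bar>X n - \<xi>\<bar> \<le> \<bar>x\<bar>"
          using X1 by (simp add: pos_divide_le_eq)
        then show "norm ((1 / (X n - \<xi>)) *\<^sub>R (exp (- (\<i> * of_real (x * X n))) - exp (- (\<i> * of_real (x * \<xi>)))) * g x)
         \<le> cmod (of_real x * g x)"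
          unfolding norm_mult norm_scaleR norm_of_real by (intro mult_right_mono) (auto simp del: of_real_mult)
      qed
    qed auto
  qed
  then show ?thesis
    unfolding has_vector_derivative_iff_tendsto_quotient .
qed

text \<open>The derivative of \<open>exp (- (\<i> * of_real (x * \<xi>))) * g x\<close> in
  \<open>x\<close> is integrable with total integral 0, since the product tends to 0 at both ends;
  expanding it gives the formula.\<close>

lemma fourier_deriv:
  assumes d: "\<And>x. (g has_vector_derivative g' x) (at x)" and g'c: "\<And>x. isCont g' x"
    and g: "integrable lborel g" and g': "integrable lborel g'"
    and lim: "(g \<longlongrightarrow> 0) at_top" "(g \<longlongrightarrow> 0) at_bot"
  shows "fourier g' \<xi> = \<i> * of_real \<xi> * fourier g \<xi>"
proof -
  define e where "e x = exp (- (\<i> * of_real (x * \<xi>)))" for x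
  define h where "h x = e x * g' x - \<i> * of_real \<xi> * (e x * g x)" for x
  have e1: "cmod (e x) = 1" for x unfolding e_def by (rule cmod_exp_minus_i)
  have gc: "isCont g x" for x using d has_vector_derivative_continuous by blast
  have ed: "(e has_vector_derivative e x * (- \<i> * of_real \<xi>)) (at x)" for x
  proof -
    have "((\<lambda>z. exp (- (\<i> * (z * of_real \<xi>)))) has_field_derivative exp (- (\<i> * (of_real x * of_real \<xi>))) * (- \<i> * of_real \<xi>)) (at (of_real x))"
      by (auto intro!: derivative_eq_intros)
    from has_vector_derivative_real_field[OF this] show ?thesis by (simp add: e_def[abs_def])
  qed
  have ec: "isCont e x" for x using ed has_vector_derivative_continuous by blast
  have hd: "((\<lambda>x. e x * g x) has_vector_derivative h x) (at x)" for x
    using has_vector_derivative_mult[OF ed[of x] d[of x]] by (simp add: h_def algebra_simps)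
  have ie: "integrable lborel (\<lambda>x. e x * g x)" "integrable lborel (\<lambda>x. e x * g' x)"
    unfolding e_def by (intro integrable_exp_mult g g')+
  have ih: "integrable lborel h" unfolding h_def by (intro Bochner_Integration.integrable_diff ie integrable_mult_right)
  have l0: "((\<lambda>x. e x * g x) \<longlongrightarrow> 0) F" if "(g \<longlongrightarrow> 0) F" for F
    by (rule Lim_null_comparison[OF _ tendsto_norm_zero[OF that]]) (simp add: norm_mult e1)
  have "(LBINT x=-\<infinity>..\<infinity>. h x) = 0 - 0"
  proof (rule interval_integral_FTC_integrable)
    show "((\<lambda>x. e x * g x) has_vector_derivative h x) (at x)" for x by (rule hd)
    show "isCont h x" for x unfolding h_def by (intro continuous_intros ec gc g'c)
    show "set_integrable lborel (einterval (- \<infinity>) \<infinity>) h" using ih by (simp add: set_integrable_def)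
    show "(((\<lambda>x. e x * g x) \<circ> real_of_ereal) \<longlongrightarrow> 0) (at_right (- \<infinity>))"
      by (simp add: ereal_tendsto_simps1 l0 lim)
    show "(((\<lambda>x. e x * g x) \<circ> real_of_ereal) \<longlongrightarrow> 0) (at_left \<infinity>)"
      by (simp add: ereal_tendsto_simps1 l0 lim)
  qed auto
  then have "(LINT x|lborel. h x) = 0"
    by (simp add: interval_lebesgue_integral_def set_lebesgue_integral_def)
  then have "(LINT x|lborel. e x * g' x) - (LINT x|lborel. \<i> * of_real \<xi> * (e x * g x)) = 0"
    unfolding h_def by (subst (asm) Bochner_Integration.integral_diff) (auto intro!: ie)
  then show ?thesis by (simp add: fourier_def e_def)
qed

lemma borel_measurable_fourier [measurable]:
  assumes "integrable lborel g"
  shows "fourier g \<in> borel_measurable borel"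
  using isCont_fourier[OF assms] by (intro borel_measurable_continuous_onI) (simp add: continuous_at_imp_continuous_on)

section \<open>Gaussian weights and the upper bound in Plancherel's theorem\<close>

lemma fourier_multiplication:
  assumes u: "integrable lborel u" and v: "integrable lborel v"
  shows "(LINT \<xi>|lborel. fourier u \<xi> * v \<xi>) = (LINT x|lborel. u x * fourier v x)"
proof -
  have [measurable]: "u \<in> borel_measurable borel" "v \<in> borel_measurable borel"
    using borel_measurable_integrable[OF u] borel_measurable_integrable[OF v] by auto
  have "integrable (lborel \<Otimes>\<^sub>M lborel) (case_prod (\<lambda>x \<xi>. exp (- (\<i> * of_real (x * \<xi>))) * u x * v \<xi>))"
  proof (rule lborel_pair.Fubini_integrable)
    show "case_prod (\<lambda>x \<xi>. exp (- (\<i> * of_real (x * \<xi>))) * u x * v \<xi>) \<in> borel_measurable (lborel \<Otimes>\<^sub>M lborel)"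
      by measurable
    show "integrable lborel (\<lambda>x. LINT y|lborel. norm (case (x, y) of (x, \<xi>) \<Rightarrow> exp (- (\<i> * of_real (x * \<xi>))) * u x * v \<xi>))"
      using u by (simp add: norm_mult)
    show "AE x in lborel. integrable lborel (\<lambda>y. case (x, y) of (x, \<xi>) \<Rightarrow> exp (- (\<i> * of_real (x * \<xi>))) * u x * v \<xi>)"
    proof (rule AE_I2)
      fix x
      show "integrable lborel (\<lambda>y. case (x, y) of (x, \<xi>) \<Rightarrow> exp (- (\<i> * of_real (x * \<xi>))) * u x * v \<xi>)"
        using integrable_mult_right[OF integrable_exp_mult[OF v, of x], of "u x"] by (simp add: mult_ac)
    qed
  qed
  from lborel_pair.Fubini_integral[OF this]
  have "(LINT \<xi>|lborel. (LINT x|lborel. exp (- (\<i> * of_real (x * \<xi>))) * u x * v \<xi>)) =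
     (LINT x|lborel. (LINT \<xi>|lborel. exp (- (\<i> * of_real (x * \<xi>))) * u x * v \<xi>))" .
  moreover have "(LINT x|lborel. exp (- (\<i> * of_real (x * \<xi>))) * u x * v \<xi>) = fourier u \<xi> * v \<xi>" for \<xi>
    unfolding fourier_def by (rule integral_mult_left_zero)
  moreover have "(LINT \<xi>|lborel. exp (- (\<i> * of_real (x * \<xi>))) * u x * v \<xi>) = u x * fourier v x" for x
    unfolding fourier_def by (subst integral_mult_right_zero[symmetric]) (simp add: mult_ac)
  ultimately show ?thesis by (simp only:)
qed

text \<open>A rescaling of the characteristic function of the standard normal law. Stating the
  result as a normal density makes its total mass 1 available.\<close>

lemma fourier_gaussian:
  assumes d: "\<delta> > 0"
  shows "fourier (\<lambda>\<xi>. of_real (exp (- (\<delta> * \<xi>)\<^sup>2 / 2))) y = of_real (2 * pi * normal_density 0 \<delta> y)"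
    and "integrable lborel (\<lambda>\<xi>. complex_of_real (exp (- (\<delta> * \<xi>)\<^sup>2 / 2)))"
proof -
  have "(LINT x|lborel. std_normal_density x *\<^sub>R exp (\<i> * of_real (s * x))) = of_real (exp (- s\<^sup>2 / 2))" for s
    using fun_cong[OF char_std_normal_distribution, of s] unfolding char_def
    by (subst (asm) integral_density) (auto simp: normal_density_nonneg)
  moreover have "(LINT x|lborel. std_normal_density x *\<^sub>R exp (\<i> * of_real (s * x)))
      = of_real (1 / sqrt (2 * pi)) * (LINT x|lborel. of_real (exp (- x\<^sup>2 / 2)) * exp (\<i> * of_real (s * x)))" for s
    unfolding std_normal_density_def scaleR_conv_of_real of_real_mult mult.assoc integral_mult_right_zero ..
  ultimately have "of_real (sqrt (2 * pi)) * (of_real (1 / sqrt (2 * pi)) * (LINT x|lborel. of_real (exp (- x\<^sup>2 / 2)) * exp (\<i> * of_real (s * x))))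
      = of_real (sqrt (2 * pi)) * complex_of_real (exp (- s\<^sup>2 / 2))" for s by (simp only:)
  then have c: "(LINT x|lborel. of_real (exp (- x\<^sup>2 / 2)) * exp (\<i> * of_real (s * x))) = of_real (sqrt (2 * pi) * exp (- s\<^sup>2 / 2))" for s
    unfolding mult.assoc[symmetric] of_real_mult[symmetric] by simp
  have "fourier (\<lambda>\<xi>. of_real (exp (- (\<delta> * \<xi>)\<^sup>2 / 2))) y =
     \<bar>1 / \<delta>\<bar> *\<^sub>R (LINT x|lborel. exp (- (\<i> * of_real ((0 + 1 / \<delta> * x) * y))) * of_real (exp (- (\<delta> * (0 + 1 / \<delta> * x))\<^sup>2 / 2)))"
    unfolding fourier_def by (rule lborel_integral_real_affine) (use d in auto)
  also have "\<dots> = (1 / \<delta>) *\<^sub>R (LINT x|lborel. of_real (exp (- x\<^sup>2 / 2)) * exp (\<i> * of_real ((- y / \<delta>) * x)))"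
    using d by (simp add: mult_ac)
  also have "\<dots> = of_real (sqrt (2 * pi) / \<delta> * exp (- (y / \<delta>)\<^sup>2 / 2))"
    unfolding c by (simp add: scaleR_conv_of_real)
  also have "sqrt (2 * pi) / \<delta> * exp (- (y / \<delta>)\<^sup>2 / 2) = 2 * pi * normal_density 0 \<delta> y"
    using d by (simp add: normal_density_def real_sqrt_mult power_divide field_simps)
  finally show "fourier (\<lambda>\<xi>. of_real (exp (- (\<delta> * \<xi>)\<^sup>2 / 2))) y = of_real (2 * pi * normal_density 0 \<delta> y)" .
  have "integrable lborel (\<lambda>x. sqrt (2 * pi) * std_normal_density x)" by (intro integrable_mult_right integrable_normal_density) auto
  then have "integrable lborel (\<lambda>x::real. exp (- x\<^sup>2 / 2))" by (simp add: std_normal_density_def)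
  from lborel_integrable_real_affine[OF this, of \<delta> 0] d
  show "integrable lborel (\<lambda>\<xi>. complex_of_real (exp (- (\<delta> * \<xi>)\<^sup>2 / 2)))" by (intro integrable_of_real) auto
qed

text \<open>The Bochner integral of a non-integrable function is 0, so the bound holds for every
  \<open>f\<close>.\<close>

lemma nn_integral_norm_integral_le:
  fixes f :: "'a \<Rightarrow> complex"
  shows "ennreal (cmod (integral\<^sup>L M f)) \<le> (\<integral>\<^sup>+x. ennreal (cmod (f x)) \<partial>M)"
  by (cases "integrable M f") (auto simp: integral_norm_bound_ennreal not_integrable_integral_eq)

text \<open>Two uses of the multiplication formula turn the left side into a double integral of
  \<open>g x\<close> and \<open>cnj (g y)\<close> against the kernel
  \<open>2 * pi * k (y - x)\<close>. Since \<open>k\<close> has mass 1 in either variable, a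
  Schur-type estimate bounds it, uniformly in \<delta>.\<close>

lemma fourier_gaussian_weighted_le:
  assumes g: "integrable lborel g" and d: "\<delta> > 0"
  shows "(\<integral>\<^sup>+\<xi>. ennreal ((cmod (fourier g \<xi>))\<^sup>2 * exp (- (\<delta> * \<xi>)\<^sup>2 / 2)) \<partial>lborel)
     \<le> ennreal (2 * pi) * (\<integral>\<^sup>+x. ennreal ((cmod (g x))\<^sup>2) \<partial>lborel)"
proof -
  define w :: "real \<Rightarrow> complex" where "w \<xi> = of_real (exp (- (\<delta> * \<xi>)\<^sup>2 / 2))" for \<xi>
  define k where "k y = normal_density 0 \<delta> y" for y
  have k0: "k y \<ge> 0" for y by (simp add: k_def normal_density_nonneg)
  have kint: "(\<integral>\<^sup>+y. ennreal (k y) \<partial>lborel) = 1"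
    unfolding k_def using d by (subst nn_integral_eq_integral) (auto simp: normal_density_nonneg)
  have kshift: "(\<integral>\<^sup>+y. ennreal (k (y - x)) \<partial>lborel) = 1" for x
    using nn_integral_real_affine[of "\<lambda>y. ennreal (k y)" 1 "- x"] kint by (simp add: k_def add.commute)
  have kshift': "(\<integral>\<^sup>+x. ennreal (k (y - x)) \<partial>lborel) = 1" for y
    using nn_integral_real_affine[of "\<lambda>y. ennreal (k y)" "- 1" y] kint by (simp add: k_def)
  have [measurable]: "g \<in> borel_measurable borel" using borel_measurable_integrable[OF g] by simp
  have [measurable]: "fourier g \<in> borel_measurable borel" using g by measurable
  have [measurable]: "k \<in> borel_measurable borel" unfolding k_def by measurable
  have wi: "integrable lborel w" using fourier_gaussian(2)[OF d] by (simp add: w_def[abs_def])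
  have [measurable]: "w \<in> borel_measurable borel" using borel_measurable_integrable[OF wi] by simp
  have [measurable]: "(\<lambda>\<xi>. cnj (fourier g \<xi>)) \<in> borel_measurable borel"
    by (intro borel_measurable_continuous_onI continuous_at_imp_continuous_on ballI isCont_cnj isCont_fourier g)
  define M where "M = (LINT x|lborel. cmod (g x))"
  have M: "cmod (fourier g \<xi>) \<le> M" for \<xi> unfolding M_def by (rule cmod_fourier_le)
  have i1: "integrable lborel (\<lambda>\<xi>. cnj (fourier g \<xi>) * w \<xi>)"
  proof (rule Bochner_Integration.integrable_bound[of _ "\<lambda>\<xi>. M * w \<xi>"])
    show "integrable lborel (\<lambda>\<xi>. M * w \<xi>)" using wi by (rule integrable_mult_right)
    show "AE \<xi> in lborel. norm (cnj (fourier g \<xi>) * w \<xi>) \<le> norm (M * w \<xi>)"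
      using M by (intro AE_I2) (auto simp: norm_mult intro!: mult_right_mono order_trans[OF M])
  qed measurable
  have ie: "integrable lborel (\<lambda>\<xi>. exp (\<i> * of_real (x * \<xi>)) * w \<xi>)" for x
    using integrable_exp_mult[OF wi, of "- x"] by (simp add: mult.commute[of x])
  have inner: "fourier (\<lambda>\<xi>. cnj (fourier g \<xi>) * w \<xi>) x = cnj (LINT y|lborel. g y * of_real (2 * pi * k (y - x)))" for x
  proof -
    have "fourier (\<lambda>\<xi>. cnj (fourier g \<xi>) * w \<xi>) x = (LINT \<xi>|lborel. cnj (fourier g \<xi> * (exp (\<i> * of_real (x * \<xi>)) * w \<xi>)))"
      unfolding fourier_def[of "\<lambda>\<xi>. cnj (fourier g \<xi>) * w \<xi>"]
      by (rule Bochner_Integration.integral_cong) (auto simp: w_def exp_cnj mult_ac)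
    also have "\<dots> = cnj (LINT \<xi>|lborel. fourier g \<xi> * (exp (\<i> * of_real (x * \<xi>)) * w \<xi>))"
      by (rule Bochner_Integration.integral_cnj)
    also have "(LINT \<xi>|lborel. fourier g \<xi> * (exp (\<i> * of_real (x * \<xi>)) * w \<xi>)) =
       (LINT y|lborel. g y * fourier (\<lambda>\<xi>. exp (\<i> * of_real (x * \<xi>)) * w \<xi>) y)"
      by (rule fourier_multiplication[OF g ie])
    \<comment> \<open>Modulating the Gaussian translates its transform, which produces the
      convolution kernel.\<close>
    also have "fourier (\<lambda>\<xi>. exp (\<i> * of_real (x * \<xi>)) * w \<xi>) = (\<lambda>y. of_real (2 * pi * k (y - x)))"
    proof
      fix y
      have "fourier (\<lambda>\<xi>. exp (\<i> * of_real (x * \<xi>)) * w \<xi>) y = fourier w (y - x)"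
        unfolding fourier_def mult.assoc[symmetric] mult_exp_exp
        by (rule Bochner_Integration.integral_cong) (simp_all add: algebra_simps)
      also have "\<dots> = of_real (2 * pi * k (y - x))"
        using fourier_gaussian(1)[OF d, of "y - x"] by (simp add: w_def[abs_def] k_def)
      finally show "fourier (\<lambda>\<xi>. exp (\<i> * of_real (x * \<xi>)) * w \<xi>) y = of_real (2 * pi * k (y - x))" .
    qed
    finally show ?thesis .
  qed
  have "(\<integral>\<^sup>+\<xi>. ennreal ((cmod (fourier g \<xi>))\<^sup>2 * exp (- (\<delta> * \<xi>)\<^sup>2 / 2)) \<partial>lborel) =
      ennreal (cmod (LINT \<xi>|lborel. fourier g \<xi> * (cnj (fourier g \<xi>) * w \<xi>)))"
  proof -
    have eq: "fourier g \<xi> * (cnj (fourier g \<xi>) * w \<xi>) = of_real ((cmod (fourier g \<xi>))\<^sup>2 * exp (- (\<delta> * \<xi>)\<^sup>2 / 2))" for \<xi>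
      unfolding w_def of_real_mult complex_norm_square by (simp add: mult_ac)
    have "integrable lborel (\<lambda>\<xi>. fourier g \<xi> * (cnj (fourier g \<xi>) * w \<xi>))"
    proof (rule Bochner_Integration.integrable_bound[of _ "\<lambda>\<xi>. M * (cnj (fourier g \<xi>) * w \<xi>)"])
      show "integrable lborel (\<lambda>\<xi>. M * (cnj (fourier g \<xi>) * w \<xi>))" using i1 by (rule integrable_mult_right)
      show "AE \<xi> in lborel. norm (fourier g \<xi> * (cnj (fourier g \<xi>) * w \<xi>)) \<le> norm (M * (cnj (fourier g \<xi>) * w \<xi>))"
        using M by (intro AE_I2) (auto simp: norm_mult intro!: mult_right_mono order_trans[OF M])
    qed measurable
    then have "integrable lborel (\<lambda>\<xi>. (cmod (fourier g \<xi>))\<^sup>2 * exp (- (\<delta> * \<xi>)\<^sup>2 / 2))"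
      unfolding eq by (simp only: complex_of_real_integrable_eq)
    then show ?thesis
      unfolding eq integral_complex_of_real norm_of_real
      by (subst nn_integral_eq_integral) auto
  qed
  also have "(LINT \<xi>|lborel. fourier g \<xi> * (cnj (fourier g \<xi>) * w \<xi>)) =
      (LINT x|lborel. g x * cnj (LINT y|lborel. g y * of_real (2 * pi * k (y - x))))"
    unfolding fourier_multiplication[OF g i1] inner ..
  also have "ennreal (cmod \<dots>) \<le> (\<integral>\<^sup>+x. ennreal (cmod (g x)) * ennreal (cmod (LINT y|lborel. g y * of_real (2 * pi * k (y - x)))) \<partial>lborel)"
    by (rule order_trans[OF nn_integral_norm_integral_le]) (simp add: norm_mult ennreal_mult)
  also have "\<dots> \<le> (\<integral>\<^sup>+x. ennreal (cmod (g x)) * (\<integral>\<^sup>+y. ennreal (cmod (g y) * (2 * pi * k (y - x))) \<partial>lborel) \<partial>lborel)"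
    by (intro nn_integral_mono mult_left_mono order_trans[OF nn_integral_norm_integral_le])
       (auto simp: norm_mult k0 abs_mult intro!: nn_integral_mono)
  also have "\<dots> = (\<integral>\<^sup>+x. (\<integral>\<^sup>+y. ennreal (cmod (g x) * (cmod (g y) * (2 * pi * k (y - x)))) \<partial>lborel) \<partial>lborel)"
    by (subst nn_integral_cmult[symmetric]) (auto simp: ennreal_mult k0)
  \<comment> \<open>AM-GM separates \<open>g x\<close> from \<open>g y\<close>; each summand is then
    integrated first in the variable that occurs only in the kernel.\<close>
  also have "\<dots> \<le> (\<integral>\<^sup>+x. (\<integral>\<^sup>+y. ennreal (pi * (cmod (g x))\<^sup>2) * ennreal (k (y - x)) + ennreal (pi * (cmod (g y))\<^sup>2) * ennreal (k (y - x)) \<partial>lborel) \<partial>lborel)"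
  proof (intro nn_integral_mono)
    fix x y
    have "2 * cmod (g x) * cmod (g y) * (pi * k (y - x)) \<le> ((cmod (g x))\<^sup>2 + (cmod (g y))\<^sup>2) * (pi * k (y - x))"
      by (intro mult_right_mono sum_squares_bound) (simp add: k0)
    then have "ennreal (cmod (g x) * (cmod (g y) * (2 * pi * k (y - x)))) \<le> ennreal (pi * (cmod (g x))\<^sup>2 * k (y - x) + pi * (cmod (g y))\<^sup>2 * k (y - x))"
      by (intro ennreal_leI) (simp add: algebra_simps)
    also have "\<dots> = ennreal (pi * (cmod (g x))\<^sup>2) * ennreal (k (y - x)) + ennreal (pi * (cmod (g y))\<^sup>2) * ennreal (k (y - x))"
      by (simp add: k0 ennreal_plus ennreal_mult)
    finally show "ennreal (cmod (g x) * (cmod (g y) * (2 * pi * k (y - x)))) \<le> ennreal (pi * (cmod (g x))\<^sup>2) * ennreal (k (y - x)) + ennreal (pi * (cmod (g y))\<^sup>2) * ennreal (k (y - x))" .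
  qed
  also have "\<dots> = (\<integral>\<^sup>+x. (\<integral>\<^sup>+y. ennreal (pi * (cmod (g x))\<^sup>2) * ennreal (k (y - x)) \<partial>lborel) \<partial>lborel)
      + (\<integral>\<^sup>+x. (\<integral>\<^sup>+y. ennreal (pi * (cmod (g y))\<^sup>2) * ennreal (k (y - x)) \<partial>lborel) \<partial>lborel)"
    by (subst nn_integral_add, measurable)+
  also have "(\<integral>\<^sup>+x. (\<integral>\<^sup>+y. ennreal (pi * (cmod (g x))\<^sup>2) * ennreal (k (y - x)) \<partial>lborel) \<partial>lborel) = (\<integral>\<^sup>+x. ennreal (pi * (cmod (g x))\<^sup>2) \<partial>lborel)"
    by (subst nn_integral_cmult) (auto simp: kshift)
  also have "(\<integral>\<^sup>+x. (\<integral>\<^sup>+y. ennreal (pi * (cmod (g y))\<^sup>2) * ennreal (k (y - x)) \<partial>lborel) \<partial>lborel) =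
      (\<integral>\<^sup>+y. (\<integral>\<^sup>+x. ennreal (pi * (cmod (g y))\<^sup>2) * ennreal (k (y - x)) \<partial>lborel) \<partial>lborel)"
    by (rule lborel_pair.Fubini'[symmetric]) measurable
  also have "\<dots> = (\<integral>\<^sup>+x. ennreal (pi * (cmod (g x))\<^sup>2) \<partial>lborel)"
    by (subst nn_integral_cmult) (auto simp: kshift')
  also have "(\<integral>\<^sup>+x. ennreal (pi * (cmod (g x))\<^sup>2) \<partial>lborel) + (\<integral>\<^sup>+x. ennreal (pi * (cmod (g x))\<^sup>2) \<partial>lborel)
      = ennreal (2 * pi) * (\<integral>\<^sup>+x. ennreal ((cmod (g x))\<^sup>2) \<partial>lborel)"
    by (simp add: ennreal_mult nn_integral_cmult flip: mult_2 mult.assoc)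
  finally show ?thesis .
qed

text \<open>The weights with \<delta> = 1 / (n + 1) tend to 1 pointwise while the Gaussian bound
  stays fixed, so Fatou's lemma removes them.\<close>

lemma Plancherel_le:
  assumes g: "integrable lborel g"
  shows "(\<integral>\<^sup>+\<xi>. ennreal ((cmod (fourier g \<xi>))\<^sup>2) \<partial>lborel) \<le> ennreal (2 * pi) * (\<integral>\<^sup>+x. ennreal ((cmod (g x))\<^sup>2) \<partial>lborel)"
proof -
  have [measurable]: "fourier g \<in> borel_measurable borel" using g by measurable
  define u where "u n \<xi> = ennreal ((cmod (fourier g \<xi>))\<^sup>2 * exp (- (inverse (real (Suc n)) * \<xi>)\<^sup>2 / 2))" for n \<xi>
  have "(\<lambda>n. u n \<xi>) \<longlonglongrightarrow> ennreal ((cmod (fourier g \<xi>))\<^sup>2 * exp (- (0 * \<xi>)\<^sup>2 / 2))" for \<xi>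
    unfolding u_def by (intro tendsto_ennrealI tendsto_intros LIMSEQ_inverse_real_of_nat) simp
  then have "ennreal ((cmod (fourier g \<xi>))\<^sup>2) = liminf (\<lambda>n. u n \<xi>)" for \<xi>
    by (subst lim_imp_Liminf) auto
  then have "(\<integral>\<^sup>+\<xi>. ennreal ((cmod (fourier g \<xi>))\<^sup>2) \<partial>lborel) = (\<integral>\<^sup>+\<xi>. liminf (\<lambda>n. u n \<xi>) \<partial>lborel)" by simp
  also have "\<dots> \<le> liminf (\<lambda>n. (\<integral>\<^sup>+\<xi>. u n \<xi> \<partial>lborel))"
    by (rule nn_integral_liminf) (simp add: u_def)
  also have "\<dots> \<le> liminf (\<lambda>n. ennreal (2 * pi) * (\<integral>\<^sup>+x. ennreal ((cmod (g x))\<^sup>2) \<partial>lborel))"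
    unfolding u_def by (intro Liminf_mono always_eventually allI fourier_gaussian_weighted_le g) auto
  finally show ?thesis by (simp add: Liminf_const)
qed

lemma Plancherel_integrable_le:
  assumes g: "integrable lborel g" and g2: "integrable lborel (\<lambda>x. (cmod (g x))\<^sup>2)"
  shows "integrable lborel (\<lambda>\<xi>. (cmod (fourier g \<xi>))\<^sup>2)"
    and "(LINT \<xi>|lborel. (cmod (fourier g \<xi>))\<^sup>2) \<le> 2 * pi * (LINT x|lborel. (cmod (g x))\<^sup>2)"
proof -
  have [measurable]: "fourier g \<in> borel_measurable borel" using g by measurable
  have le: "(\<integral>\<^sup>+\<xi>. ennreal ((cmod (fourier g \<xi>))\<^sup>2) \<partial>lborel) \<le> ennreal (2 * pi * (LINT x|lborel. (cmod (g x))\<^sup>2))"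
    using Plancherel_le[OF g] nn_integral_eq_integral[OF g2] by (simp add: ennreal_mult)
  show i: "integrable lborel (\<lambda>\<xi>. (cmod (fourier g \<xi>))\<^sup>2)"
    by (rule integrableI_nonneg) (use le in \<open>auto simp: less_top[symmetric] top_unique\<close>)
  show "(LINT \<xi>|lborel. (cmod (fourier g \<xi>))\<^sup>2) \<le> 2 * pi * (LINT x|lborel. (cmod (g x))\<^sup>2)"
    using le unfolding nn_integral_eq_integral[OF i AE_I2[OF zero_le_power2]] by (subst (asm) ennreal_le_iff) auto
qed

section \<open>The dispersive estimate\<close>

text \<open>Collects what the Fourier lemmas ask of \<open>\<phi>\<close>, \<open>\<phi>'\<close>
  and \<open>x * \<phi>'\<close>. Square integrability follows from |h|^2 \<le> B |h|.\<close>

lemma quadratic_decay_facts: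
  fixes h :: "real \<Rightarrow> complex"
  assumes c: "\<And>x. isCont h x" and B: "\<And>x. cmod (h x) \<le> B / (1 + x\<^sup>2)"
  shows "integrable lborel h" "integrable lborel (\<lambda>x. (cmod (h x))\<^sup>2)"
    "(h \<longlongrightarrow> 0) at_top" "(h \<longlongrightarrow> 0) at_bot"
proof -
  have [measurable]: "h \<in> borel_measurable borel"
    using c by (intro borel_measurable_continuous_onI) (simp add: continuous_at_imp_continuous_on)
  have B0: "B \<ge> 0" using order_trans[OF norm_ge_zero B[of 0]] by simp
  have hB: "cmod (h x) \<le> B" for x
  proof -
    have "B / (1 + x\<^sup>2) \<le> B / 1" using B0 by (intro divide_left_mono) (auto simp: add_pos_nonneg)
    then show ?thesis using B[of x] by simp
  qed
  have "integrable lborel (\<lambda>x::real. B * (1 / (1\<^sup>2 + x\<^sup>2)))"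
    by (intro integrable_mult_right cauchy_density_integral) simp
  then have iB: "integrable lborel (\<lambda>x::real. B / (1 + x\<^sup>2))" by simp
  show h: "integrable lborel h"
    by (rule Bochner_Integration.integrable_bound[OF iB])
       (use B B0 in \<open>auto intro!: AE_I2\<close>)
  have "integrable lborel (\<lambda>x. B * h x)" using h by simp
  then show "integrable lborel (\<lambda>x. (cmod (h x))\<^sup>2)"
    by (rule Bochner_Integration.integrable_bound)
       (use hB B0 in \<open>auto intro!: AE_I2 mult_right_mono simp: norm_mult power2_eq_square\<close>)
  have l: "(h \<longlongrightarrow> 0) F" if "filterlim (\<lambda>x::real. x\<^sup>2) at_top F" for F
  proof (rule Lim_null_comparison)
    show "eventually (\<lambda>x. norm (h x) \<le> B / (1 + x\<^sup>2)) F" using B by simp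
    show "((\<lambda>x. B / (1 + x\<^sup>2)) \<longlongrightarrow> 0) F"
      by (intro tendsto_divide_0[OF tendsto_const] filterlim_at_top_imp_at_infinity
            filterlim_tendsto_add_at_top[OF tendsto_const] that)
  qed
  show "(h \<longlongrightarrow> 0) at_top" by (intro l filterlim_pow_at_top filterlim_ident) simp
  show "(h \<longlongrightarrow> 0) at_bot" by (intro l filterlim_pow_at_bot_even filterlim_ident) simp_all
qed

text \<open>Adding the Schwartz bounds of orders \<open>k\<close> and \<open>k + 2\<close> yields
  the factor \<open>1 + x\<^sup>2\<close>.\<close>

lemma schwartz_derivs_quadratic_decay:
  assumes "\<phi> \<in> schwartz"
  shows "\<exists>B. \<forall>x. \<bar>x\<bar> ^ k * cmod ((deriv_R ^^ n) \<phi> x) \<le> B / (1 + x\<^sup>2)"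
proof -
  obtain B1 where B1: "\<bar>x\<bar> ^ k * cmod ((deriv_R ^^ n) \<phi> x) \<le> B1" for x
    using assms unfolding schwartz_def by blast
  obtain B2 where B2: "\<bar>x\<bar> ^ (k + 2) * cmod ((deriv_R ^^ n) \<phi> x) \<le> B2" for x
    using assms unfolding schwartz_def by blast
  have "\<bar>x\<bar> ^ k * cmod ((deriv_R ^^ n) \<phi> x) \<le> (B1 + B2) / (1 + x\<^sup>2)" for x
  proof -
    have "\<bar>x\<bar> ^ k * cmod ((deriv_R ^^ n) \<phi> x) * (1 + x\<^sup>2) =
        \<bar>x\<bar> ^ k * cmod ((deriv_R ^^ n) \<phi> x) + \<bar>x\<bar> ^ (k + 2) * cmod ((deriv_R ^^ n) \<phi> x)"
      by (simp add: power_add algebra_simps power2_eq_square)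
    then show ?thesis using B1[of x] B2[of x] by (simp add: pos_le_divide_eq add_pos_nonneg)
  qed
  then show ?thesis by blast
qed

lemma schwartz_has_vector_derivative:
  assumes "\<phi> \<in> schwartz"
  shows "((deriv_R ^^ n) \<phi> has_vector_derivative (deriv_R ^^ Suc n) \<phi> x) (at x)"
  using assms unfolding schwartz_def by (simp add: deriv_R_def[of "(deriv_R ^^ n) \<phi>"] vector_derivative_works[symmetric])

lemma L2_norm_sq: "(L2_norm g)\<^sup>2 = (LINT x|lborel. (cmod (g x))\<^sup>2)"
  unfolding L2_norm_def by (simp add: Bochner_Integration.integral_nonneg)

text \<open>Transforming \<open>\<phi>'\<close> multiplies by \<open>\<i> * \<xi>\<close>, and
  differentiating that transform corresponds to \<open>- \<i> * x * \<phi>'\<close>. Plancherel's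
  bound, applied to all three functions, supplies \<open>2 * pi\<close>.\<close>

lemma schwartz_weighted_pair:
  assumes "\<phi> \<in> schwartz"
  shows "weighted_pair (fourier \<phi>) (fourier (deriv_R \<phi>)) (fourier (\<lambda>x. - \<i> * (of_real x * deriv_R \<phi> x))) \<i>
    (2 * pi * ((H1_norm \<phi>)\<^sup>2 + (L2_norm (\<lambda>x. of_real x * deriv_R \<phi> x))\<^sup>2))"
proof -
  define g where "g x = of_real x * deriv_R \<phi> x" for x
  have d: "(\<phi> has_vector_derivative deriv_R \<phi> x) (at x)" for x
    using schwartz_has_vector_derivative[OF assms, of 0] by simp
  have c0: "isCont \<phi> x" for x using d has_vector_derivative_continuous by blast
  have c1: "isCont (deriv_R \<phi>) x" for x
    using schwartz_has_vector_derivative[OF assms, of 1] has_vector_derivative_continuous by fastforce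
  have cg: "isCont g x" for x unfolding g_def by (intro continuous_intros c1)
  obtain B0 where "cmod (\<phi> x) \<le> B0 / (1 + x\<^sup>2)" for x
    using schwartz_derivs_quadratic_decay[OF assms, of 0 0] by auto
  note p = quadratic_decay_facts[OF c0 this]
  obtain B1 where "cmod (deriv_R \<phi> x) \<le> B1 / (1 + x\<^sup>2)" for x
    using schwartz_derivs_quadratic_decay[OF assms, of 0 1] by auto
  note p' = quadratic_decay_facts[OF c1 this]
  obtain B2 where "cmod (g x) \<le> B2 / (1 + x\<^sup>2)" for x
    using schwartz_derivs_quadratic_decay[OF assms, of 1 1] by (auto simp: g_def norm_mult)
  note pg = quadratic_decay_facts[OF cg this]
  have ig: "integrable lborel (\<lambda>x. - \<i> * g x)" "integrable lborel (\<lambda>x. (cmod (- \<i> * g x))\<^sup>2)"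
    using pg by (simp_all add: norm_mult)
  note P = Plancherel_integrable_le[OF p(1,2)] Plancherel_integrable_le[OF p'(1,2)] Plancherel_integrable_le[OF ig]
  show ?thesis
    unfolding g_def[symmetric]
  proof
    show "isCont (fourier \<phi>) \<xi>" "isCont (fourier (\<lambda>x. - \<i> * g x)) \<xi>" for \<xi>
      by (intro isCont_fourier p ig)+
    show "(fourier (deriv_R \<phi>) has_vector_derivative fourier (\<lambda>x. - \<i> * g x) \<xi>) (at \<xi>)" for \<xi>
      unfolding g_def by (intro fourier_has_vector_derivative p' pg(1)[unfolded g_def])
    show "fourier (deriv_R \<phi>) \<xi> = \<i> * of_real \<xi> * fourier \<phi> \<xi>" for \<xi>
      by (intro fourier_deriv d c1 p p')
    show "integrable lborel (\<lambda>\<xi>. (cmod (fourier \<phi> \<xi>))\<^sup>2 + (cmod (fourier (deriv_R \<phi>) \<xi>))\<^sup>2 + (cmod (fourier (\<lambda>x. - \<i> * g x) \<xi>))\<^sup>2)"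
      by (intro Bochner_Integration.integrable_add P)
    have "(LINT \<xi>|lborel. (cmod (fourier \<phi> \<xi>))\<^sup>2 + (cmod (fourier (deriv_R \<phi>) \<xi>))\<^sup>2 + (cmod (fourier (\<lambda>x. - \<i> * g x) \<xi>))\<^sup>2)
      = (LINT \<xi>|lborel. (cmod (fourier \<phi> \<xi>))\<^sup>2) + (LINT \<xi>|lborel. (cmod (fourier (deriv_R \<phi>) \<xi>))\<^sup>2)
        + (LINT \<xi>|lborel. (cmod (fourier (\<lambda>x. - \<i> * g x) \<xi>))\<^sup>2)"
      by (simp only: Bochner_Integration.integral_add Bochner_Integration.integrable_add P)
    also have "\<dots> \<le> 2 * pi * (L2_norm \<phi>)\<^sup>2 + 2 * pi * (L2_norm (deriv_R \<phi>))\<^sup>2 + 2 * pi * (L2_norm g)\<^sup>2"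
      using P by (simp add: L2_norm_sq norm_mult)
    also have "\<dots> = 2 * pi * ((H1_norm \<phi>)\<^sup>2 + (L2_norm g)\<^sup>2)"
      by (simp add: H1_norm_def distrib_left)
    finally show "(LINT \<xi>|lborel. (cmod (fourier \<phi> \<xi>))\<^sup>2 + (cmod (fourier (deriv_R \<phi>) \<xi>))\<^sup>2 + (cmod (fourier (\<lambda>x. - \<i> * g x) \<xi>))\<^sup>2)
      \<le> 2 * pi * ((H1_norm \<phi>)\<^sup>2 + (L2_norm (\<lambda>x. g x))\<^sup>2)" .
  qed simp
qed

theorem theorem1p1:
  fixes \<Phi> :: "real \<Rightarrow> real"
  assumes "\<And>\<xi>. \<Phi> \<xi> = \<bar>\<xi>\<bar> powr (1/2)"
  shows "\<exists>C>0. \<forall>t::real. \<forall>\<phi>\<in>schwartz.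
           Linf_norm (propagator \<Phi> t \<phi>)
             \<le> ereal (C * (1 + \<bar>t\<bar>) powr (-1/2) *
                 (H1_norm \<phi> + L2_norm (\<lambda>x. of_real x * deriv_R \<phi> x)))"
\<comment> \<open>9000 is 3000 from \<open>dispersive_bound\<close> times 3 from
  \<open>sqrt Q \<le> 3 * (H + L)\<close>; the latter uses
  \<open>2 * pi < 8 \<le> 9\<close>.\<close>
proof (intro exI[of _ 9000] conjI allI ballI)
  fix t :: real and \<phi> assume \<phi>: "\<phi> \<in> schwartz"
  define H where "H = H1_norm \<phi>"
  define L where "L = L2_norm (\<lambda>x. of_real x * deriv_R \<phi> x)"
  define Q where "Q = 2 * pi * (H\<^sup>2 + L\<^sup>2)"
  define R where "R = (1 + \<bar>t\<bar>) powr (- 1 / 2)"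
  interpret weighted_pair "fourier \<phi>" "fourier (deriv_R \<phi>)" "fourier (\<lambda>x. - \<i> * (of_real x * deriv_R \<phi> x))" \<i> Q
    using schwartz_weighted_pair[OF \<phi>] by (simp add: Q_def H_def L_def)
  have HL: "H \<ge> 0" "L \<ge> 0"
    by (auto simp: H_def L_def H1_norm_def L2_norm_def Bochner_Integration.integral_nonneg)
  have "sqrt Q \<le> 3 * (H + L)"
  proof (rule real_le_lsqrt)
    have "Q \<le> 9 * (H\<^sup>2 + L\<^sup>2)" unfolding Q_def using pi_less_4 by (intro mult_right_mono) auto
    also have "\<dots> \<le> (3 * (H + L))\<^sup>2" using HL by (simp add: power2_eq_square algebra_simps)
    finally show "Q \<le> (3 * (H + L))\<^sup>2" .
  qed (use HL Q_nonneg in auto)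
  then have Q: "3000 * sqrt Q * R \<le> 9000 * R * (H + L)"
    using mult_right_mono[of "sqrt Q" "3 * (H + L)" "3000 * R"] by (simp add: R_def algebra_simps)
  define g where "g \<xi> = exp (\<i> * of_real (t * \<Phi> \<xi>)) * fourier \<phi> \<xi>" for \<xi>
  have Phi: "\<Phi> \<xi> = sqrt \<bar>\<xi>\<bar>" for \<xi> by (simp add: assms powr_half_sqrt)
  have g: "integrable lborel g"
    unfolding g_def Phi by (rule Bochner_Integration.integrable_bound[OF f_integrable]) (auto simp: norm_mult simp del: of_real_mult)
  \<comment> \<open>The inverse transform is a reflected forward transform, so measurability of
    transforms carries over; \<open>Linf_norm\<close> would be infinite without it.\<close>
  have propagator_eq: "propagator \<Phi> t \<phi> x = 1 / (2 * of_real pi) * fourier g (- x)" for x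
    by (simp add: propagator_def inverse_fourier_def fourier_def g_def mult.commute[of x])
  have "cmod (propagator \<Phi> t \<phi> x) \<le> 9000 * R * (H + L)" for x
  proof -
    have "fourier g (- x) = (LINT \<xi>|lborel. exp (\<i> * of_real (x * \<xi> + t * sqrt \<bar>\<xi>\<bar>)) * fourier \<phi> \<xi>)"
      unfolding fourier_def[of g] g_def Phi mult.assoc[symmetric] mult_exp_exp
      by (rule Bochner_Integration.integral_cong) (simp_all add: algebra_simps)
    then have "cmod (fourier g (- x)) \<le> 3000 * sqrt Q * R"
      using dispersive_bound[of x t] by (simp add: R_def)
    \<comment> \<open>The normalizing factor \<open>1 / (2 * pi)\<close> is below 1 and is
      discarded.\<close>
    moreover have "cmod (propagator \<Phi> t \<phi> x) \<le> cmod (fourier g (- x))"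
      unfolding propagator_eq norm_mult using pi_gt3 by (intro mult_left_le_one_le) (auto simp: norm_divide norm_mult)
    ultimately show ?thesis using Q by linarith
  qed
  moreover have "propagator \<Phi> t \<phi> \<in> borel_measurable borel"
  proof -
    have [measurable]: "fourier g \<in> borel_measurable borel" using g by measurable
    show ?thesis unfolding propagator_eq[abs_def] by measurable
  qed
  ultimately have "Linf_norm (propagator \<Phi> t \<phi>) \<le> ereal (9000 * R * (H + L))"
    unfolding Linf_norm_def by (intro esssup_I AE_I2) auto
  then show "Linf_norm (propagator \<Phi> t \<phi>)
             \<le> ereal (9000 * (1 + \<bar>t\<bar>) powr (-1/2) *
                 (H1_norm \<phi> + L2_norm (\<lambda>x. of_real x * deriv_R \<phi> x)))"
    by (simp add: R_def H_def L_def)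
qed simp

end
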